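(* If $X$ is a 2-Segal set, then there is a strict factorization system on the edgewise subdivision $\mathrm{sd}(X)$ of $X$ whose left class is isomorphic to $\mathrm{dec}_\top(X)^{\mathrm{op}}$ and whose right class is isomorphic to $\mathrm{dec}_\bot(X)$.
   Context: Small categories are identified with their nerves; a simplicial set is called a category if it is (isomorphic to) the nerve of a category. 2-Segal set: a simplicial set $X$ is upper 2-Segal if for all $0<i<n$ the square with top $d_0\colon X_{n+1}\to X_n$, left $d_{i+1}\colon X_{n+1}\to X_n$, right $d_i\colon X_n\to X_{n-1}$, bottom $d_0\colon X_n\to X_{n-1}$ is a pullback; it is lower 2-Segal if for all $0<i<n$ the square with top $d_{n+1}\colon X_{n+1}\to X_n$, left $d_i\colon X_{n+1}\to X_n$, right $d_i\colon X_n\to X_{n-1}$, bottom $d_n\colon X_n\to X_{n-1}$ is a pullback. It is 2-Segal if it is both. Décalage: $\mathrm{dec}_\top(X)_n=X_{n+1}$ with the top face and degeneracy maps of $X$ discarded; $\mathrm{dec}_\bot(X)_n=X_{n+1}$ with the bottom face and degeneracy maps of $X$ discarded (so its $i$th operators are $d_{i+1},s_{i+1}$ of $X$). Edgewise subdivision: $\mathrm{sd}(X)=X\circ Q^{\mathrm{op}}$, where $Q\colon\Delta\to\Delta$, $Q([n])=[n]^{\mathrm{op}}\star[n]\cong[2n+1]$, and for $f\colon[n]\to[m]$: $Q(f)(t)=m-f(n-t)$ if $t\le n$ and $Q(f)(t)=m+1+f(t-n-1)$ if $t\ge n+1$. So $\mathrm{sd}(X)_n=X_{2n+1}$. When $X$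 is 2-Segal, it is known that $\mathrm{sd}(X)$, $\mathrm{dec}_\top(X)$ and $\mathrm{dec}_\bot(X)$ are all categories. A strict factorization system on a category is a pair $(L,R)$ of wide subcategories (the left and right classes) such that each morphism factors uniquely as $r\circ\ell$ with $\ell\in L$ and $r\in R$. *)

theory Defs
  imports Main "HOL-Library.FuncSet"
begin

section \<open>The simplex category\<close>

text \<open>
  \<open>Delta m n\<close> is the set of morphisms \<open>[m] \<rightarrow> [n]\<close> of the simplex category, where \<open>[n]\<close> is \<open>{..n}\<close>.
  Morphisms are extensional functions, so that HOL equality is equality of maps; identities and
  composites are therefore restricted to the source.
\<close>

definition Delta :: "nat \<Rightarrow> nat \<Rightarrow> (nat \<Rightarrow> nat) set" where
  "Delta m n = {f \<in> {..m} \<rightarrow>\<^sub>E {..n}. mono_on {..m} f}"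

definition coface :: "nat \<Rightarrow> nat \<Rightarrow> nat \<Rightarrow> nat" where
  "coface n i = restrict (\<lambda>t. if t < i then t else Suc t) {..n - 1}"

definition codegeneracy :: "nat \<Rightarrow> nat \<Rightarrow> nat \<Rightarrow> nat" where
  "codegeneracy n i = restrict (\<lambda>t. if t \<le> i then t else t - 1) {..Suc n}"

section \<open>Simplicial sets\<close>

text \<open>
  A simplicial set is a contravariant functor from the simplex category to sets:
  \<open>act X m n f\<close> is the map \<open>X\<^sub>n \<rightarrow> X\<^sub>m\<close> induced by \<open>f : [m] \<rightarrow> [n]\<close>.
\<close>

record 'a sset =
  simplices :: "nat \<Rightarrow> 'a set"
  act :: "nat \<Rightarrow> nat \<Rightarrow> (nat \<Rightarrow> nat) \<Rightarrow> 'a \<Rightarrow> 'a"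

definition simplicial_set :: "'a sset \<Rightarrow> bool" where
  "simplicial_set X \<longleftrightarrow>
     (\<forall>m n. \<forall>f \<in> Delta m n. act X m n f \<in> simplices X n \<rightarrow> simplices X m) \<and>
     (\<forall>n. \<forall>x \<in> simplices X n. act X n n (restrict id {..n}) x = x) \<and>
     (\<forall>k m n. \<forall>g \<in> Delta k m. \<forall>f \<in> Delta m n. \<forall>x \<in> simplices X n.
        act X k n (compose {..k} f g) x = act X k m g (act X m n f x))"

definition sset_iso :: "'a sset \<Rightarrow> 'b sset \<Rightarrow> bool" (infix "\<cong>\<^sub>s" 50) where
  "X \<cong>\<^sub>s Y \<longleftrightarrow>
     (\<exists>\<phi>. (\<forall>n. bij_betw (\<phi> n) (simplices X n) (simplices Y n)) \<and>
          (\<forall>m n. \<forall>f \<in> Delta m n. \<forall>x \<in> simplices X n.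
             \<phi> m (act X m n f x) = act Y m n f (\<phi> n x)))"

text \<open>
  \<open>face X n i\<close> is \<open>d\<^sub>i : X\<^sub>n \<rightarrow> X\<^sub>n\<^sub>-\<^sub>1\<close> (meaningful for \<open>i \<le> n\<close> and \<open>n \<ge> 1\<close>), and
  \<open>degeneracy X n i\<close> is \<open>s\<^sub>i : X\<^sub>n \<rightarrow> X\<^sub>n\<^sub>+\<^sub>1\<close> (meaningful for \<open>i \<le> n\<close>).
\<close>

definition face :: "'a sset \<Rightarrow> nat \<Rightarrow> nat \<Rightarrow> 'a \<Rightarrow> 'a" where
  "face X n i = act X (n - 1) n (coface n i)"

definition degeneracy :: "'a sset \<Rightarrow> nat \<Rightarrow> nat \<Rightarrow> 'a \<Rightarrow> 'a" where
  "degeneracy X n i = act X (Suc n) n (codegeneracy n i)"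

section \<open>2-Segal sets\<close>

text \<open>
  The square with corners \<open>P\<close> (top left), \<open>A\<close> (top right), \<open>B\<close> (bottom left) and sides \<open>t\<close> (top),
  \<open>l\<close> (left), \<open>r\<close> (right), \<open>b\<close> (bottom) is a pullback of sets: the comparison map from \<open>P\<close> to the
  fibre product of \<open>r\<close> and \<open>b\<close> is well defined (i.e. the square commutes) and bijective.
\<close>

definition pullback_square ::
  "'p set \<Rightarrow> 'a set \<Rightarrow> 'b set \<Rightarrow> ('p \<Rightarrow> 'a) \<Rightarrow> ('p \<Rightarrow> 'b) \<Rightarrow> ('a \<Rightarrow> 'c) \<Rightarrow> ('b \<Rightarrow> 'c) \<Rightarrow> bool" where
  "pullback_square P A B t l r b \<longleftrightarrow>
     bij_betw (\<lambda>p. (t p, l p)) P {(x, y). x \<in> A \<and> y \<in> B \<and> r x = b y}"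

definition upper_two_segal :: "'a sset \<Rightarrow> bool" where
  "upper_two_segal X \<longleftrightarrow> simplicial_set X \<and>
     (\<forall>i n. 0 < i \<and> i < n \<longrightarrow>
        pullback_square (simplices X (n + 1)) (simplices X n) (simplices X n)
          (face X (n + 1) 0) (face X (n + 1) (i + 1)) (face X n i) (face X n 0))"

definition lower_two_segal :: "'a sset \<Rightarrow> bool" where
  "lower_two_segal X \<longleftrightarrow> simplicial_set X \<and>
     (\<forall>i n. 0 < i \<and> i < n \<longrightarrow>
        pullback_square (simplices X (n + 1)) (simplices X n) (simplices X n)
          (face X (n + 1) (n + 1)) (face X (n + 1) i) (face X n i) (face X n n))"

definition two_segal :: "'a sset \<Rightarrow> bool" where
  "two_segal X \<longleftrightarrow> upper_two_segal X \<and> lower_two_segal X"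

section \<open>Decalage, edgewise subdivision and opposites\<close>

text \<open>
  Each is precomposition with an endofunctor of the simplex category: \<open>[n] \<star> [0]\<close>, \<open>[0] \<star> [n]\<close>,
  \<open>[n]\<^sup>o\<^sup>p \<star> [n]\<close> and \<open>[n]\<^sup>o\<^sup>p\<close> respectively.  That the two decalages discard the top, respectively
  bottom, face and degeneracy operators of \<open>X\<close> is proved below.
\<close>

definition top_map :: "nat \<Rightarrow> nat \<Rightarrow> (nat \<Rightarrow> nat) \<Rightarrow> nat \<Rightarrow> nat" where
  "top_map m n f = restrict (\<lambda>t. if t \<le> m then f t else Suc n) {..Suc m}"

definition dec_top :: "'a sset \<Rightarrow> 'a sset" where
  "dec_top X = \<lparr>simplices = \<lambda>n. simplices X (Suc n),
                act = \<lambda>m n f. act X (Suc m) (Suc n) (top_map m n f)\<rparr>"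

definition bot_map :: "nat \<Rightarrow> nat \<Rightarrow> (nat \<Rightarrow> nat) \<Rightarrow> nat \<Rightarrow> nat" where
  "bot_map m n f = restrict (\<lambda>t. if t = 0 then 0 else Suc (f (t - 1))) {..Suc m}"

definition dec_bot :: "'a sset \<Rightarrow> 'a sset" where
  "dec_bot X = \<lparr>simplices = \<lambda>n. simplices X (Suc n),
                act = \<lambda>m n f. act X (Suc m) (Suc n) (bot_map m n f)\<rparr>"

definition Q_map :: "nat \<Rightarrow> nat \<Rightarrow> (nat \<Rightarrow> nat) \<Rightarrow> nat \<Rightarrow> nat" where
  "Q_map n m f =
     restrict (\<lambda>t. if t \<le> n then m - f (n - t) else m + 1 + f (t - n - 1)) {..2 * n + 1}"

definition sd :: "'a sset \<Rightarrow> 'a sset" where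
  "sd X = \<lparr>simplices = \<lambda>n. simplices X (2 * n + 1),
           act = \<lambda>m n f. act X (2 * m + 1) (2 * n + 1) (Q_map m n f)\<rparr>"

definition op_map :: "nat \<Rightarrow> nat \<Rightarrow> (nat \<Rightarrow> nat) \<Rightarrow> nat \<Rightarrow> nat" where
  "op_map m n f = restrict (\<lambda>t. n - f (m - t)) {..m}"

definition op_sset :: "'a sset \<Rightarrow> 'a sset" where
  "op_sset X = \<lparr>simplices = simplices X, act = \<lambda>m n f. act X m n (op_map m n f)\<rparr>"

section \<open>Small categories and nerves\<close>

record ('o, 'm) cat =
  Obj :: "'o set"
  Arr :: "'m set"
  Dom :: "'m \<Rightarrow> 'o"
  Cod :: "'m \<Rightarrow> 'o"
  Id :: "'o \<Rightarrow> 'm"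
  Comp :: "'m \<Rightarrow> 'm \<Rightarrow> 'm"

text \<open>\<open>Comp C g f\<close> is \<open>g \<circ> f\<close>; it is only meaningful when \<open>Dom C g = Cod C f\<close>.\<close>

definition category :: "('o, 'm) cat \<Rightarrow> bool" where
  "category C \<longleftrightarrow>
     Dom C \<in> Arr C \<rightarrow> Obj C \<and> Cod C \<in> Arr C \<rightarrow> Obj C \<and>
     (\<forall>x \<in> Obj C. Id C x \<in> Arr C \<and> Dom C (Id C x) = x \<and> Cod C (Id C x) = x) \<and>
     (\<forall>f \<in> Arr C. \<forall>g \<in> Arr C. Dom C g = Cod C f \<longrightarrow>
        Comp C g f \<in> Arr C \<and> Dom C (Comp C g f) = Dom C f \<and> Cod C (Comp C g f) = Cod C g) \<and>
     (\<forall>f \<in> Arr C. Comp C f (Id C (Dom C f)) = f \<and> Comp C (Id C (Cod C f)) f = f) \<and>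
     (\<forall>f \<in> Arr C. \<forall>g \<in> Arr C. \<forall>h \<in> Arr C. Dom C g = Cod C f \<longrightarrow> Dom C h = Cod C g \<longrightarrow>
        Comp C h (Comp C g f) = Comp C (Comp C h g) f)"

text \<open>
  Functors from the poset \<open>[n]\<close> to \<open>C\<close>, as pairs of an object map and an arrow map; the arrow
  \<open>i \<le> j\<close> of the poset is written \<open>(i, j)\<close>.
\<close>

definition simplex_functors :: "nat \<Rightarrow> ('o, 'm) cat \<Rightarrow> ((nat \<Rightarrow> 'o) \<times> (nat \<times> nat \<Rightarrow> 'm)) set" where
  "simplex_functors n C = {(F\<^sub>0, F\<^sub>1).
     F\<^sub>0 \<in> {..n} \<rightarrow>\<^sub>E Obj C \<and>
     F\<^sub>1 \<in> {(i, j). i \<le> j \<and> j \<le> n} \<rightarrow>\<^sub>E Arr C \<and>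
     (\<forall>i j. i \<le> j \<and> j \<le> n \<longrightarrow> Dom C (F\<^sub>1 (i, j)) = F\<^sub>0 i \<and> Cod C (F\<^sub>1 (i, j)) = F\<^sub>0 j) \<and>
     (\<forall>i \<le> n. F\<^sub>1 (i, i) = Id C (F\<^sub>0 i)) \<and>
     (\<forall>i j k. i \<le> j \<and> j \<le> k \<and> k \<le> n \<longrightarrow> F\<^sub>1 (i, k) = Comp C (F\<^sub>1 (j, k)) (F\<^sub>1 (i, j)))}"

definition nerve :: "('o, 'm) cat \<Rightarrow> ((nat \<Rightarrow> 'o) \<times> (nat \<times> nat \<Rightarrow> 'm)) sset" where
  "nerve C = \<lparr>simplices = \<lambda>n. simplex_functors n C,
              act = \<lambda>m n f (F\<^sub>0, F\<^sub>1).
                (restrict (\<lambda>i. F\<^sub>0 (f i)) {..m},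
                 restrict (\<lambda>(i, j). F\<^sub>1 (f i, f j)) {(i, j). i \<le> j \<and> j \<le> m})\<rparr>"

section \<open>Strict factorization systems\<close>

text \<open>A wide subcategory is given by its class of arrows.\<close>

definition wide_subcategory :: "('o, 'm) cat \<Rightarrow> 'm set \<Rightarrow> bool" where
  "wide_subcategory C L \<longleftrightarrow>
     L \<subseteq> Arr C \<and> (\<forall>x \<in> Obj C. Id C x \<in> L) \<and>
     (\<forall>f \<in> L. \<forall>g \<in> L. Dom C g = Cod C f \<longrightarrow> Comp C g f \<in> L)"

definition subcat :: "('o, 'm) cat \<Rightarrow> 'm set \<Rightarrow> ('o, 'm) cat" where
  "subcat C L = C\<lparr>Arr := L\<rparr>"

definition strict_factorization_system :: "('o, 'm) cat \<Rightarrow> 'm set \<Rightarrow> 'm set \<Rightarrow> bool" where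
  "strict_factorization_system C L R \<longleftrightarrow>
     category C \<and> wide_subcategory C L \<and> wide_subcategory C R \<and>
     (\<forall>f \<in> Arr C. \<exists>!(l, r). l \<in> L \<and> r \<in> R \<and> Dom C r = Cod C l \<and> f = Comp C r l)"

section \<open>Well-formedness\<close>

lemma DeltaI:
  assumes "\<And>t. t \<le> m \<Longrightarrow> f t \<le> n" "\<And>s t. s \<le> t \<Longrightarrow> t \<le> m \<Longrightarrow> f s \<le> f t"
  shows "restrict f {..m} \<in> Delta m n"
  using assms by (auto simp: Delta_def mono_on_def)

lemma DeltaD:
  assumes "f \<in> Delta m n"
  shows "t \<le> m \<Longrightarrow> f t \<le> n" "s \<le> t \<Longrightarrow> t \<le> m \<Longrightarrow> f s \<le> f t"
    "restrict f {..m} = f"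
  using assms by (auto simp: Delta_def mono_on_def PiE_restrict)

lemma coface_Delta: "i \<le> Suc n \<Longrightarrow> coface (Suc n) i \<in> Delta n (Suc n)"
  unfolding coface_def by (simp, rule DeltaI) auto

lemma codegeneracy_Delta: "i \<le> n \<Longrightarrow> codegeneracy n i \<in> Delta (Suc n) n"
  unfolding codegeneracy_def by (rule DeltaI) auto

lemma top_map_Delta: "f \<in> Delta m n \<Longrightarrow> top_map m n f \<in> Delta (Suc m) (Suc n)"
  unfolding top_map_def by (rule DeltaI) (auto dest: DeltaD(1) DeltaD(2) intro: le_SucI)

lemma bot_map_Delta: "f \<in> Delta m n \<Longrightarrow> bot_map m n f \<in> Delta (Suc m) (Suc n)"
  unfolding bot_map_def by (rule DeltaI) (auto simp: DeltaD(1) DeltaD(2))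

lemma Q_map_Delta: "f \<in> Delta m n \<Longrightarrow> Q_map m n f \<in> Delta (2 * m + 1) (2 * n + 1)"
  unfolding Q_map_def
proof (rule DeltaI, goal_cases)
  case (1 t)
  have "t - m - 1 \<le> m" using 1 by simp
  from DeltaD(1)[OF 1(1) this] show ?case by auto
next
  case (2 s t)
  then show ?case
    by (auto simp: DeltaD(2) intro: diff_le_mono2)
qed

lemma op_map_Delta: "f \<in> Delta m n \<Longrightarrow> op_map m n f \<in> Delta m n"
  unfolding op_map_def by (rule DeltaI) (auto simp: DeltaD(2) diff_le_mono2)

lemma simplicial_set_precompose:
  assumes X: "simplicial_set X"
    and mor: "\<And>m n f. f \<in> Delta m n \<Longrightarrow> E m n f \<in> Delta (e m) (e n)"
    and id: "\<And>n. E n n (restrict id {..n}) = restrict id {..e n}"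
    and comp: "\<And>k m n f g. g \<in> Delta k m \<Longrightarrow> f \<in> Delta m n \<Longrightarrow>
      E k n (compose {..k} f g) = compose {..e k} (E m n f) (E k m g)"
  shows "simplicial_set \<lparr>simplices = \<lambda>n. simplices X (e n),
                         act = \<lambda>m n f. act X (e m) (e n) (E m n f)\<rparr>"
  using X mor unfolding simplicial_set_def by (simp add: id comp Pi_iff)

lemma simplicial_set_dec_top: "simplicial_set X \<Longrightarrow> simplicial_set (dec_top X)"
  unfolding dec_top_def
proof (rule simplicial_set_precompose, goal_cases)
  case (2 m n f)
  show ?case by (rule top_map_Delta[OF 2(2)])
qed (auto simp: top_map_def compose_def fun_eq_iff restrict_def DeltaD(1) le_SucI)

lemma simplicial_set_dec_bot: "simplicial_set X \<Longrightarrow> simplicial_set (dec_bot X)"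
  unfolding dec_bot_def
proof (rule simplicial_set_precompose, goal_cases)
  case (2 m n f)
  show ?case by (rule bot_map_Delta[OF 2(2)])
qed (auto simp: bot_map_def compose_def fun_eq_iff restrict_def DeltaD(1))

lemma simplicial_set_op: "simplicial_set X \<Longrightarrow> simplicial_set (op_sset X)"
  unfolding op_sset_def
proof (rule simplicial_set_precompose[where e = "\<lambda>n. n"], goal_cases)
  case (2 m n f)
  show ?case by (rule op_map_Delta[OF 2(2)])
qed (auto simp: op_map_def compose_def fun_eq_iff restrict_def DeltaD(1))

lemma Q_map_comp:
  assumes "g \<in> Delta k m" "f \<in> Delta m n"
  shows "Q_map k n (compose {..k} f g) = compose {..2 * k + 1} (Q_map m n f) (Q_map k m g)"
proof
  fix t
  have "t \<le> 2 * k + 1 \<Longrightarrow> g (t - k - 1) \<le> m" "g (k - t) \<le> m"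
    using DeltaD(1)[OF assms(1)] by auto
  then show "Q_map k n (compose {..k} f g) t = compose {..2 * k + 1} (Q_map m n f) (Q_map k m g) t"
    by (auto simp: Q_map_def compose_def)
qed

lemma simplicial_set_sd: "simplicial_set X \<Longrightarrow> simplicial_set (sd X)"
  unfolding sd_def
proof (rule simplicial_set_precompose[where e = "\<lambda>n. 2 * n + 1"], goal_cases)
  case (3 n)
  show ?case by (auto simp: Q_map_def fun_eq_iff restrict_def)
qed (use Q_map_Delta Q_map_comp in auto)

lemma face_dec_top: "i \<le> Suc n \<Longrightarrow> face (dec_top X) (Suc n) i = face X (Suc (Suc n)) i"
proof -
  assume "i \<le> Suc n"
  then have "top_map n (Suc n) (coface (Suc n) i) = coface (Suc (Suc n)) i"
    by (auto simp: top_map_def coface_def fun_eq_iff restrict_def)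
  then show ?thesis by (simp add: face_def dec_top_def)
qed

lemma degeneracy_dec_top: "i \<le> n \<Longrightarrow> degeneracy (dec_top X) n i = degeneracy X (Suc n) i"
proof -
  assume "i \<le> n"
  then have "top_map (Suc n) n (codegeneracy n i) = codegeneracy (Suc n) i"
    by (auto simp: top_map_def codegeneracy_def fun_eq_iff restrict_def)
  then show ?thesis by (simp add: degeneracy_def dec_top_def)
qed

lemma face_dec_bot: "face (dec_bot X) (Suc n) i = face X (Suc (Suc n)) (Suc i)"
proof -
  have "bot_map n (Suc n) (coface (Suc n) i) = coface (Suc (Suc n)) (Suc i)"
    by (auto simp: bot_map_def coface_def fun_eq_iff restrict_def)
  then show ?thesis by (simp add: face_def dec_bot_def)
qed

lemma degeneracy_dec_bot: "degeneracy (dec_bot X) n i = degeneracy X (Suc n) (Suc i)"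
proof -
  have "bot_map (Suc n) n (codegeneracy n i) = codegeneracy (Suc n) (Suc i)"
    by (auto simp: bot_map_def codegeneracy_def fun_eq_iff restrict_def)
  then show ?thesis by (simp add: degeneracy_def dec_bot_def)
qed

lemma category_subcat: "category C \<Longrightarrow> wide_subcategory C L \<Longrightarrow> category (subcat C L)"
  unfolding category_def wide_subcategory_def subcat_def
  by (simp add: Pi_iff subset_iff)

lemma simplicial_set_nerve: "simplicial_set (nerve C)"
  unfolding simplicial_set_def
proof (intro conjI allI ballI, goal_cases)
  case (1 m n f)
  then show ?case
    by (auto simp: nerve_def simplex_functors_def PiE_iff Pi_iff DeltaD(1) DeltaD(2)
        intro: order_trans)
next
  case (2 n x)
  then show ?case
    by (auto simp: nerve_def simplex_functors_def fun_eq_iff restrict_def PiE_iff extensional_def)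
next
  case (3 k m n g f x)
  then show ?case
    by (auto simp: nerve_def compose_def fun_eq_iff restrict_def DeltaD(1) DeltaD(2)
        split: prod.splits)
qed

end

(*
  A 2-Segal set can be glued along triangulations of polygons.  Fans at the bottom vertex show that
  dec_bot X is Segal, fans at the top vertex that op (dec_top X) is Segal, and cutting off a bottom and
  a top ear in turn that sd X is Segal; a Segal set is the nerve of the category whose arrows are its
  1-simplices.  The degenerate arrows 1' 0' 0 0 and 0' 0' 0 1 of sd X form copies of op (dec_top X) and
  dec_bot X, and a 3-simplex 1' 0' 0 1 is the same as a compatible pair of triangles 1' 0' 0 and 1' 0 1,
  i.e. an arrow of sd X is the same as a composable pair of a left and a right arrow.
*)
theory Submission
  imports Defs
begin

section \<open>Pullback squares\<close>

text \<open>An object of \<open>sd X\<close> is an edge of \<open>X\<close>, and an arrow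
  \<open>1' 0' 0 1\<close> runs from the inner edge \<open>0' 0\<close> to the outer edge
  \<open>1' 1\<close>. A left arrow moves only the initial endpoint, a right arrow only the final
  one. Factoring as left followed by right passes through the edge \<open>1' 0\<close>, which is the
  diagonal used by the lower 2-Segal square on 3-simplices; this fixes which triangulation gives
  existence and uniqueness. The obstacle is that the defining squares glue two n-simplices along a
  common (n-1)-simplex, while the Segal conditions need pieces that meet in a single edge of
  \<open>X\<close>. Pasting squares shrinks the overlap one inner vertex at a time until only an
  edge is left. The Segal condition is likewise kept as a square that adds one edge at the end of
  the spine, so that a polygon square proves it once its maps are rewritten. One comparison
  argument, for a Segal set included in another with the same vertices, then gives all three nerve
  isomorphisms.\<close>

lemma pullback_square_iff:
  "pullback_square P A B t l r b \<longleftrightarrow>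
     t \<in> P \<rightarrow> A \<and> l \<in> P \<rightarrow> B \<and> (\<forall>p\<in>P. r (t p) = b (l p)) \<and>
     (\<forall>p\<in>P. \<forall>q\<in>P. t p = t q \<longrightarrow> l p = l q \<longrightarrow> p = q) \<and>
     (\<forall>x\<in>A. \<forall>y\<in>B. r x = b y \<longrightarrow> (\<exists>p\<in>P. t p = x \<and> l p = y))"
proof
  assume L: "pullback_square P A B t l r b"
  have inj: "inj_on (\<lambda>p. (t p, l p)) P"
    and im: "(\<lambda>p. (t p, l p)) ` P = {(x, y). x \<in> A \<and> y \<in> B \<and> r x = b y}"
    using L unfolding pullback_square_def bij_betw_def by auto
  have "(t p, l p) \<in> {(x, y). x \<in> A \<and> y \<in> B \<and> r x = b y}" if "p \<in> P" for p
    using that unfolding im[symmetric] by (rule imageI)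
  moreover have "\<exists>p\<in>P. t p = x \<and> l p = y" if "x \<in> A" "y \<in> B" "r x = b y" for x y
  proof -
    have "(x, y) \<in> (\<lambda>p. (t p, l p)) ` P" unfolding im using that by simp
    then show ?thesis by auto
  qed
  ultimately show "t \<in> P \<rightarrow> A \<and> l \<in> P \<rightarrow> B \<and> (\<forall>p\<in>P. r (t p) = b (l p)) \<and>
     (\<forall>p\<in>P. \<forall>q\<in>P. t p = t q \<longrightarrow> l p = l q \<longrightarrow> p = q) \<and>
     (\<forall>x\<in>A. \<forall>y\<in>B. r x = b y \<longrightarrow> (\<exists>p\<in>P. t p = x \<and> l p = y))"
    using inj by (auto simp: inj_on_def)
next
  assume "t \<in> P \<rightarrow> A \<and> l \<in> P \<rightarrow> B \<and> (\<forall>p\<in>P. r (t p) = b (l p)) \<and>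
     (\<forall>p\<in>P. \<forall>q\<in>P. t p = t q \<longrightarrow> l p = l q \<longrightarrow> p = q) \<and>
     (\<forall>x\<in>A. \<forall>y\<in>B. r x = b y \<longrightarrow> (\<exists>p\<in>P. t p = x \<and> l p = y))"
  then show "pullback_square P A B t l r b"
    unfolding pullback_square_def bij_betw_def inj_on_def
    by (auto simp: Pi_iff image_iff) metis
qed

lemma pullback_squareE:
  assumes "pullback_square P A B t l r b" "x \<in> A" "y \<in> B" "r x = b y"
  obtains p where "p \<in> P" "t p = x" "l p = y"
  using assms unfolding pullback_square_iff by blast

lemma pullback_square_eqI:
  assumes "pullback_square P A B t l r b" "p \<in> P" "q \<in> P" "t p = t q" "l p = l q"
  shows "p = q"
  using assms unfolding pullback_square_iff by blast

lemma pullback_square_commutes: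
  assumes "pullback_square P A B t l r b" "p \<in> P"
  shows "r (t p) = b (l p)" "t p \<in> A" "l p \<in> B"
  using assms unfolding pullback_square_iff by blast+

text \<open>Pasted squares carry composite maps. This replaces them by single operators, although
  the two agree only on the simplices in question.\<close>

lemma pullback_square_cong:
  assumes "pullback_square P A B t l r b"
    and "\<And>p. p \<in> P \<Longrightarrow> t p = t' p" "\<And>p. p \<in> P \<Longrightarrow> l p = l' p"
    and "\<And>x. x \<in> A \<Longrightarrow> r x = r' x" "\<And>y. y \<in> B \<Longrightarrow> b y = b' y"
  shows "pullback_square P A B t' l' r' b'"
proof -
  have "(t p, l p) = (t' p, l' p)" if "p \<in> P" for p using assms(2,3) that by simp
  moreover have "{(x, y). x \<in> A \<and> y \<in> B \<and> r x = b y} = {(x, y). x \<in> A \<and> y \<in> B \<and> r' x = b' y}"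
    using assms(4,5) by auto
  ultimately show ?thesis
    using assms(1) bij_betw_cong[of P "\<lambda>p. (t p, l p)" "\<lambda>p. (t' p, l' p)"]
    unfolding pullback_square_def by simp
qed

lemma pullback_square_flip:
  assumes "pullback_square P A B t l r b"
  shows "pullback_square P B A l t b r"
proof -
  have "\<exists>p\<in>P. l p = y \<and> t p = x" if "y \<in> B" "x \<in> A" "b y = r x" for x y
    using pullback_squareE[OF assms that(2,1) that(3)[symmetric]] by metis
  moreover have "p = q" if "p \<in> P" "q \<in> P" "l p = l q" "t p = t q" for p q
    by (rule pullback_square_eqI[OF assms that(1,2,4,3)])
  ultimately show ?thesis
    unfolding pullback_square_iff using pullback_square_commutes[OF assms] by auto
qed

lemma pullback_square_paste:
  assumes 1: "pullback_square P A B t l r b" and 2: "pullback_square B D E b l' r' b'"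
    and r: "r \<in> A \<rightarrow> D"
  shows "pullback_square P A E t (\<lambda>p. l' (l p)) (\<lambda>x. r' (r x)) b'"
proof -
  note c = pullback_square_commutes[OF 1] pullback_square_commutes[OF 2]
  have "p = q" if "p \<in> P" "q \<in> P" "t p = t q" "l' (l p) = l' (l q)" for p q
  proof -
    have "b (l p) = b (l q)" using c(1)[OF that(1)] c(1)[OF that(2)] that(3) by simp
    with c that have "l p = l q" by - (rule pullback_square_eqI[OF 2], simp_all)
    then show ?thesis by (rule pullback_square_eqI[OF 1 that(1-3)])
  qed
  moreover have "\<exists>p\<in>P. t p = x \<and> l' (l p) = y" if xy: "x \<in> A" "y \<in> E" "r' (r x) = b' y" for x y
  proof -
    have "r x \<in> D" using r xy by blast
    from pullback_squareE[OF 2 this xy(2,3)] obtain q where q: "q \<in> B" "b q = r x" "l' q = y" .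
    from pullback_squareE[OF 1 xy(1) q(1) q(2)[symmetric]] obtain p where
      "p \<in> P" "t p = x" "l p = q" .
    with q show ?thesis by blast
  qed
  moreover have "r' (r (t p)) = b' (l' (l p))" if "p \<in> P" for p
    using c that by simp
  ultimately show ?thesis
    unfolding pullback_square_iff using c by auto
qed

text \<open>Converse of pasting. The outer square supplies \<open>p\<close>, and the lower square
  forces \<open>l p = y\<close>, because it determines an element of \<open>B\<close> by its images
  under \<open>b\<close> and \<open>l'\<close>.\<close>

lemma pullback_square_cancel:
  assumes 1: "pullback_square P A E t (\<lambda>p. l' (l p)) (\<lambda>x. r' (r x)) b'"
    and 2: "pullback_square B D E b l' r' b'"
    and r: "r \<in> A \<rightarrow> D" and l: "l \<in> P \<rightarrow> B" and comm: "\<And>p. p \<in> P \<Longrightarrow> r (t p) = b (l p)"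
  shows "pullback_square P A B t l r b"
proof -
  note c = pullback_square_commutes[OF 1] pullback_square_commutes[OF 2]
  have "\<exists>p\<in>P. t p = x \<and> l p = y" if xy: "x \<in> A" "y \<in> B" "r x = b y" for x y
  proof -
    have "r' (r x) = b' (l' y)" "l' y \<in> E" using xy c by auto
    from pullback_squareE[OF 1 xy(1) this(2,1)] obtain p where
      p: "p \<in> P" "t p = x" "l' (l p) = l' y" .
    have "l p \<in> B" "b (l p) = b y" using l p(1,2) comm[OF p(1)] xy(3) by auto
    with p xy have "l p = y" by - (rule pullback_square_eqI[OF 2], simp_all)
    with p show ?thesis by blast
  qed
  moreover have "p = q" if "p \<in> P" "q \<in> P" "t p = t q" "l p = l q" for p q
    by (rule pullback_square_eqI[OF 1]) (simp_all add: that)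
  ultimately show ?thesis
    unfolding pullback_square_iff using c l comm by auto
qed

section \<open>Operators indexed by arbitrary functions\<close>

text \<open>The restriction makes values of \<open>f\<close> beyond \<open>k\<close> irrelevant, so
  vertex lists such as \<open>(!) [0, 2, 3]\<close> and plain lambda terms serve as operators.
  Equality of two operators becomes a pointwise check on \<open>{..k}\<close>.\<close>

definition pull :: "'a sset \<Rightarrow> nat \<Rightarrow> nat \<Rightarrow> (nat \<Rightarrow> nat) \<Rightarrow> 'a \<Rightarrow> 'a" where
  "pull X k n f = act X k n (restrict f {..k})"

definition smap :: "nat \<Rightarrow> nat \<Rightarrow> (nat \<Rightarrow> nat) \<Rightarrow> bool" where
  "smap k n f \<longleftrightarrow> (\<forall>t\<le>k. f t \<le> n) \<and> (\<forall>t\<le>k. \<forall>s\<le>t. f s \<le> f t)"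

lemma smap_Delta: "smap k n f \<Longrightarrow> restrict f {..k} \<in> Delta k n"
  unfolding smap_def by (rule DeltaI) auto

lemma Delta_smap: "f \<in> Delta k n \<Longrightarrow> smap k n f"
  unfolding smap_def using DeltaD(1,2) by blast

lemma act_eq_pull: "f \<in> Delta k n \<Longrightarrow> act X k n f = pull X k n f"
  unfolding pull_def by (simp add: DeltaD(3))

lemma pull_cong: "(\<forall>t\<le>k. f t = g t) \<Longrightarrow> pull X k n f = pull X k n g"
  unfolding pull_def by (rule arg_cong[of _ _ "\<lambda>h. act X k n h"]) (auto simp: restrict_def fun_eq_iff)

lemma pull_closed:
  "simplicial_set X \<Longrightarrow> smap k n f \<Longrightarrow> x \<in> simplices X n \<Longrightarrow> pull X k n f x \<in> simplices X k"
  unfolding pull_def by (drule smap_Delta) (auto simp: simplicial_set_def)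

lemma pull_id:
  assumes "simplicial_set X" "x \<in> simplices X n" "\<forall>t\<le>n. f t = t"
  shows "pull X n n f x = x"
proof -
  have "pull X n n f = pull X n n id" by (rule pull_cong) (simp add: assms)
  then show ?thesis using assms(1,2) by (simp add: pull_def simplicial_set_def)
qed

lemma pull_pull:
  assumes "simplicial_set X" "x \<in> simplices X n" "smap k m g" "smap m n f"
  shows "pull X k m g (pull X m n f x) = pull X k n (\<lambda>t. f (g t)) x"
proof -
  have "compose {..k} (restrict f {..m}) (restrict g {..k}) = restrict (\<lambda>t. f (g t)) {..k}"
    using assms(3) by (auto simp: compose_def smap_def fun_eq_iff restrict_def)
  moreover have "act X k n (compose {..k} (restrict f {..m}) (restrict g {..k})) x
      = pull X k m g (pull X m n f x)"
    using assms(1,2) smap_Delta[OF assms(3)] smap_Delta[OF assms(4)]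
    unfolding pull_def simplicial_set_def by blast
  ultimately show ?thesis by (simp add: pull_def)
qed

lemma pull_pull_eq:
  assumes "simplicial_set X" "x \<in> simplices X n" "smap k m g" "smap m n f"
    and "\<forall>t\<le>k. f (g t) = h t"
  shows "pull X k m g (pull X m n f x) = pull X k n h x"
  using fun_cong[OF pull_cong[OF assms(5)], of X n x] by (simp only: pull_pull[OF assms(1-4)])

lemma all_le_Suc: "(\<forall>t\<le>Suc n. P t) \<longleftrightarrow> P 0 \<and> (\<forall>t\<le>n. P (Suc t))"
  by (metis Suc_le_mono le0 not0_implies_Suc)

text \<open>Unrolls a quantifier over the vertices of a small simplex, which turns the comparison of
  two vertex lists into computation.\<close>

lemma all_le_small:
  "(\<forall>t\<le>0. P t) \<longleftrightarrow> P (0::nat)"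
  "(\<forall>t\<le>Suc n. P t) \<longleftrightarrow> P 0 \<and> (\<forall>t\<le>n. P (Suc t))"
  "(\<forall>t\<le>numeral k. P t) \<longleftrightarrow> P 0 \<and> (\<forall>t\<le>pred_numeral k. P (Suc t))"
  by (simp_all add: all_le_Suc numeral_eq_Suc)

lemma smap_list [simp]:
  "smap 0 n ((!) [a]) \<longleftrightarrow> a \<le> n"
  "smap (Suc 0) n ((!) [a, b]) \<longleftrightarrow> a \<le> b \<and> b \<le> n"
  "smap 2 n ((!) [a, b, c]) \<longleftrightarrow> a \<le> b \<and> b \<le> c \<and> c \<le> n"
  "smap 3 n ((!) [a, b, c, d]) \<longleftrightarrow> a \<le> b \<and> b \<le> c \<and> c \<le> d \<and> d \<le> n"
  "smap 5 n ((!) [a, b, c, d, e, f]) \<longleftrightarrow> a \<le> b \<and> b \<le> c \<and> c \<le> d \<and> d \<le> e \<and> e \<le> f \<and> f \<le> n"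
  by (simp_all add: smap_def all_le_small) (meson order_trans)+

definition skip :: "nat \<Rightarrow> nat \<Rightarrow> nat" where
  "skip i t = (if t < i then t else Suc t)"

lemma skip_simps [simp]: "t < i \<Longrightarrow> skip i t = t" "i \<le> t \<Longrightarrow> skip i t = Suc t"
  by (simp_all add: skip_def)

lemma smap_skip: "smap n (Suc n) (skip i)"
  by (auto simp: smap_def skip_def)

lemma smap_id: "k \<le> n \<Longrightarrow> smap k n (\<lambda>t. t)"
  by (auto simp: smap_def)

lemma smap_Suc: "smap n (Suc n) Suc"
  by (auto simp: smap_def)

lemma face_eq_pull: "face X (Suc n) i = pull X n (Suc n) (skip i)"
  by (simp add: face_def pull_def coface_def skip_def[abs_def])

lemma face_bot: "face X (Suc n) 0 = pull X n (Suc n) Suc"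
  unfolding face_eq_pull by (rule pull_cong) auto

lemma face_top: "face X (Suc n) (Suc n) = pull X n (Suc n) (\<lambda>t. t)"
  unfolding face_eq_pull by (rule pull_cong) auto

section \<open>Triangulations of polygons\<close>

text \<open>The edge \<open>{0, m}\<close> cuts the polygon \<open>[m + 1]\<close> into \<open>{0..m}\<close> and the triangle \<open>{0, m, m + 1}\<close>.\<close>

lemma lower_two_segal_ear:
  assumes X: "lower_two_segal X"
  shows "pullback_square (simplices X (Suc (Suc m))) (simplices X (Suc m)) (simplices X 2)
    (pull X (Suc m) (Suc (Suc m)) (\<lambda>t. t)) (pull X 2 (Suc (Suc m)) ((!) [0, Suc m, Suc (Suc m)]))
    (pull X 1 (Suc m) ((!) [0, Suc m])) (pull X 1 2 ((!) [0, 1]))"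
proof -
  have sX: "simplicial_set X" using X by (simp add: lower_two_segal_def)
  note [simp] = sX
  show ?thesis
  proof (induction m)
    \<comment> \<open>The polygon is itself the ear: its chord is the side \<open>{0, 1}\<close>,
      and both vertical maps are identities.\<close>
    case 0
    show ?case
      unfolding pullback_square_iff
    proof (intro conjI ballI impI, goal_cases)
      case 1 then show ?case by (auto intro: pull_closed smap_id)
    next
      case 2 then show ?case by (auto intro: pull_closed)
    next
      case (3 p) then show ?case
        by (simp add: pull_pull smap_id) (rule fun_cong[OF pull_cong], simp add: all_le_small)
    next
      case (4 p q) then show ?case by (simp add: pull_id all_le_small flip: numeral_2_eq_2)
    next
      case (5 x y)
      have "pull X (Suc 0) 1 ((!) [0, Suc 0]) x = x"
        using 5 by (simp add: pull_id all_le_small)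
      moreover have "pull X (Suc 0) 2 ((!) [0, Suc 0]) = pull X (Suc 0) 2 (\<lambda>t. t)"
        by (rule pull_cong) (simp add: all_le_small)
      ultimately show ?case using 5
        by (intro bexI[of _ y]) (simp_all add: pull_id all_le_small flip: numeral_2_eq_2)
    qed
  next
    case (Suc m)
    \<comment> \<open>The inner index is 1: deleting vertex 1 shrinks the polygon but keeps the ear
      and the chord, so the induction hypothesis can be stacked below this square.\<close>
    have "pullback_square (simplices X (Suc (Suc (Suc m)))) (simplices X (Suc (Suc m))) (simplices X (Suc (Suc m)))
          (face X (Suc (Suc (Suc m))) (Suc (Suc (Suc m)))) (face X (Suc (Suc (Suc m))) 1) (face X (Suc (Suc m)) 1) (face X (Suc (Suc m)) (Suc (Suc m)))"
      using X unfolding lower_two_segal_def by (metis Suc_eq_plus1 zero_less_one Suc_less_eq One_nat_def zero_less_Suc)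
    then have sq: "pullback_square (simplices X (Suc (Suc (Suc m)))) (simplices X (Suc (Suc m))) (simplices X (Suc (Suc m)))
          (pull X (Suc (Suc m)) (Suc (Suc (Suc m))) (\<lambda>t. t)) (pull X (Suc (Suc m)) (Suc (Suc (Suc m))) (skip 1))
          (pull X (Suc m) (Suc (Suc m)) (skip 1)) (pull X (Suc m) (Suc (Suc m)) (\<lambda>t. t))"
      by (simp only: face_top face_eq_pull[of _ _ 1] face_eq_pull[of _ _ 2])
    show ?case
      by (rule pullback_square_cong[OF pullback_square_paste[OF sq Suc.IH]])
        (auto intro!: pull_closed pull_pull_eq simp: smap_skip all_le_small del: allI)
  qed
qed

lemma lower_two_segal_square:
  assumes "lower_two_segal X"
  shows "pullback_square (simplices X 3) (simplices X 2) (simplices X 2)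
    (pull X 2 3 (\<lambda>t. t)) (pull X 2 3 ((!) [0, 2, 3])) (pull X 1 2 ((!) [0, 2])) (pull X 1 2 ((!) [0, 1]))"
  using lower_two_segal_ear[OF assms, of 1] by (simp add: numeral_eq_Suc)

text \<open>Mirror image at the bottom vertex: the chord \<open>{1, m + 2}\<close> of the polygon
  \<open>[m + 2]\<close> splits off the triangle \<open>{0, 1, m + 2}\<close>.\<close>

lemma upper_two_segal_ear:
  assumes X: "upper_two_segal X"
  shows "pullback_square (simplices X (Suc (Suc m))) (simplices X (Suc m)) (simplices X 2)
    (pull X (Suc m) (Suc (Suc m)) Suc) (pull X 2 (Suc (Suc m)) ((!) [0, 1, Suc (Suc m)]))
    (pull X 1 (Suc m) ((!) [0, Suc m])) (pull X 1 2 ((!) [1, 2]))"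
proof -
  have sX: "simplicial_set X" using X by (simp add: upper_two_segal_def)
  note [simp] = sX
  show ?thesis
  proof (induction m)
    case 0
    show ?case
      unfolding pullback_square_iff
    proof (intro conjI ballI impI, goal_cases)
      case 1 then show ?case by (auto intro: pull_closed smap_Suc)
    next
      case 2 then show ?case by (auto intro: pull_closed)
    next
      case (3 p) then show ?case
        by (simp add: pull_pull smap_Suc) (rule fun_cong[OF pull_cong], simp add: all_le_small)
    next
      case (4 p q) then show ?case by (simp add: pull_id all_le_small flip: numeral_2_eq_2)
    next
      case (5 x y)
      have "pull X (Suc 0) 1 ((!) [0, Suc 0]) x = x"
        using 5 by (simp add: pull_id all_le_small)
      moreover have "pull X (Suc 0) 2 ((!) [Suc 0, 2]) = pull X (Suc 0) 2 Suc"
        by (rule pull_cong) (simp add: all_le_small)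
      ultimately show ?case using 5
        by (intro bexI[of _ y]) (simp_all add: pull_id all_le_small flip: numeral_2_eq_2)
    qed
  next
    case (Suc m)
    \<comment> \<open>Vertex 2 is deleted here. Once vertex 0 is gone it is renumbered 1, hence
      \<open>skip 2\<close> on the left and \<open>skip 1\<close> on the right.\<close>
    have "pullback_square (simplices X (Suc (Suc (Suc m)))) (simplices X (Suc (Suc m))) (simplices X (Suc (Suc m)))
          (face X (Suc (Suc (Suc m))) 0) (face X (Suc (Suc (Suc m))) 2) (face X (Suc (Suc m)) 1) (face X (Suc (Suc m)) 0)"
      using X unfolding upper_two_segal_def by (metis Suc_eq_plus1 zero_less_one Suc_less_eq One_nat_def zero_less_Suc Suc_1)
    then have sq: "pullback_square (simplices X (Suc (Suc (Suc m)))) (simplices X (Suc (Suc m))) (simplices X (Suc (Suc m)))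
          (pull X (Suc (Suc m)) (Suc (Suc (Suc m))) Suc) (pull X (Suc (Suc m)) (Suc (Suc (Suc m))) (skip 2))
          (pull X (Suc m) (Suc (Suc m)) (skip 1)) (pull X (Suc m) (Suc (Suc m)) Suc)"
      by (simp only: face_bot face_eq_pull[of _ _ 1] face_eq_pull[of _ _ 2])
    show ?case
      by (rule pullback_square_cong[OF pullback_square_paste[OF sq Suc.IH]])
        (auto intro!: pull_closed pull_pull_eq simp: smap_skip all_le_small del: allI)
  qed
qed

text \<open>
  Cutting off the two ears of \<open>[m + 3]\<close> at its bottom and top vertex leaves \<open>{1..m + 2}\<close>; the two ears
  form the quadrilateral \<open>{0, 1, m + 2, m + 3}\<close>.
\<close>

lemma two_segal_quadrilateral:
  assumes "two_segal X"
  shows "pullback_square (simplices X (Suc (Suc (Suc m)))) (simplices X (Suc m)) (simplices X 3)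
    (pull X (Suc m) (Suc (Suc (Suc m))) Suc)
    (pull X 3 (Suc (Suc (Suc m))) ((!) [0, 1, Suc (Suc m), Suc (Suc (Suc m))]))
    (pull X 1 (Suc m) ((!) [0, Suc m])) (pull X 1 3 ((!) [1, 2]))"
proof -
  have low: "lower_two_segal X" and upp: "upper_two_segal X"
    using assms by (simp_all add: two_segal_def)
  have sX [simp]: "simplicial_set X" using low by (simp add: lower_two_segal_def)
  let ?N = "Suc (Suc (Suc m))"
  \<comment> \<open>The polygon and the quadrilateral both arise by gluing on the top ear
    \<open>{0, m + 2, m + 3}\<close>. Cancelling it leaves a gluing of \<open>{0..m + 2}\<close> to
    the quadrilateral along the triangle \<open>{0, 1, m + 2}\<close>.\<close>
  have "pullback_square (simplices X ?N) (simplices X (Suc (Suc m))) (simplices X 3)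
    (pull X (Suc (Suc m)) ?N (\<lambda>t. t)) (pull X 3 ?N ((!) [0, 1, Suc (Suc m), ?N]))
    (pull X 2 (Suc (Suc m)) ((!) [0, 1, Suc (Suc m)])) (pull X 2 3 (\<lambda>t. t))"
    by (rule pullback_square_cancel[OF pullback_square_cong[OF lower_two_segal_ear[OF low]] lower_two_segal_square[OF low]])
      (auto intro!: pull_closed fun_cong[OF pull_cong]
        simp: smap_id pull_pull all_le_small del: allI)
  \<comment> \<open>That triangle is the bottom ear of \<open>{0..m + 2}\<close>; pasting removes it
    and leaves the chord \<open>{1, m + 2}\<close> as the overlap. The flips let squares that are
    adjacent horizontally be pasted vertically.\<close>
  from pullback_square_paste[OF pullback_square_flip[OF this]
      pullback_square_flip[OF upper_two_segal_ear[OF upp]]]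
  have "pullback_square (simplices X ?N) (simplices X 3) (simplices X (Suc m))
    (pull X 3 ?N ((!) [0, 1, Suc (Suc m), ?N]))
    (\<lambda>p. pull X (Suc m) (Suc (Suc m)) Suc (pull X (Suc (Suc m)) ?N (\<lambda>t. t) p))
    (\<lambda>x. pull X 1 2 ((!) [1, 2]) (pull X 2 3 (\<lambda>t. t) x)) (pull X 1 (Suc m) ((!) [0, Suc m]))"
    by (simp add: pull_closed smap_id)
  then have "pullback_square (simplices X ?N) (simplices X 3) (simplices X (Suc m))
    (pull X 3 ?N ((!) [0, 1, Suc (Suc m), ?N])) (pull X (Suc m) ?N Suc)
    (pull X 1 3 ((!) [1, 2])) (pull X 1 (Suc m) ((!) [0, Suc m]))"
    by (rule pullback_square_cong) (auto intro!: pull_pull_eq simp: smap_id smap_Suc all_le_small)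
  then show ?thesis by (rule pullback_square_flip)
qed

section \<open>Segal sets are nerves\<close>

definition vertex :: "'a sset \<Rightarrow> nat \<Rightarrow> nat \<Rightarrow> 'a \<Rightarrow> 'a" where
  "vertex Y n i = pull Y 0 n ((!) [i])"

text \<open>Equal indices are allowed and give degenerate edges; in particular
  \<open>edge Y 0 0 0\<close> is the degeneracy that becomes the identity arrow.\<close>

definition edge :: "'a sset \<Rightarrow> nat \<Rightarrow> nat \<Rightarrow> nat \<Rightarrow> 'a \<Rightarrow> 'a" where
  "edge Y n i j = pull Y 1 n ((!) [i, j])"

locale segal_set =
  fixes Y :: "'a sset"
  assumes simplicial [simp]: "simplicial_set Y"
    and spine: "\<And>n. pullback_square (simplices Y (Suc n)) (simplices Y n) (simplices Y 1)
      (pull Y n (Suc n) (\<lambda>t. t)) (edge Y (Suc n) n (Suc n)) (vertex Y n n) (vertex Y 1 0)"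
begin

section \<open>Vertices, edges and the reconstruction of a simplex from its spine\<close>

lemma vertex_closed [simp]: "y \<in> simplices Y n \<Longrightarrow> i \<le> n \<Longrightarrow> vertex Y n i y \<in> simplices Y 0"
  unfolding vertex_def by (rule pull_closed) simp_all

lemma edge_closed [simp]:
  "y \<in> simplices Y n \<Longrightarrow> i \<le> j \<Longrightarrow> j \<le> n \<Longrightarrow> edge Y n i j y \<in> simplices Y 1"
  unfolding edge_def by (rule pull_closed) simp_all

lemma vertex_pull:
  "y \<in> simplices Y n \<Longrightarrow> smap m n f \<Longrightarrow> i \<le> m \<Longrightarrow>
    vertex Y m i (pull Y m n f y) = vertex Y n (f i) y"
  unfolding vertex_def by (rule pull_pull_eq) (simp_all add: all_le_small)

lemma edge_pull:
  "y \<in> simplices Y n \<Longrightarrow> smap m n f \<Longrightarrow> i \<le> j \<Longrightarrow> j \<le> m \<Longrightarrow>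
    edge Y m i j (pull Y m n f y) = edge Y n (f i) (f j) y"
  unfolding edge_def by (rule pull_pull_eq) (simp_all add: all_le_small)

lemma vertex_edge:
  assumes "y \<in> simplices Y n" "i \<le> j" "j \<le> n"
  shows "vertex Y 1 0 (edge Y n i j y) = vertex Y n i y"
    and "vertex Y 1 1 (edge Y n i j y) = vertex Y n j y"
  using assms unfolding edge_def by (simp_all add: vertex_pull)

lemma edge_vertex:
  "y \<in> simplices Y n \<Longrightarrow> i \<le> n \<Longrightarrow> edge Y 0 0 0 (vertex Y n i y) = edge Y n i i y"
  unfolding vertex_def by (simp add: edge_pull)

lemma edge_self: "e \<in> simplices Y 1 \<Longrightarrow> edge Y 1 0 1 e = e"
  unfolding edge_def by (rule pull_id) (simp_all add: all_le_small)

lemma vertex_self: "v \<in> simplices Y 0 \<Longrightarrow> vertex Y 0 0 v = v"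
  unfolding vertex_def by (rule pull_id) (simp_all add: all_le_small)

text \<open>Induction drops the last vertex and the defining square restores it. The first vertex is
  compared separately because a 0-simplex has no spine edges.\<close>

lemma spine_eqI:
  assumes "x \<in> simplices Y n" "y \<in> simplices Y n" "vertex Y n 0 x = vertex Y n 0 y"
    and "\<And>i. i < n \<Longrightarrow> edge Y n i (Suc i) x = edge Y n i (Suc i) y"
  shows "x = y"
  using assms
proof (induction n arbitrary: x y)
  case 0
  then show ?case by (simp add: vertex_self)
next
  case (Suc n)
  have "pull Y n (Suc n) (\<lambda>t. t) x = pull Y n (Suc n) (\<lambda>t. t) y"
    by (rule Suc.IH) (use Suc.prems in \<open>simp_all add: pull_closed smap_id vertex_pull edge_pull\<close>)
  then show ?case
    using Suc.prems by - (rule pullback_square_eqI[OF spine[of n]], simp_all)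
qed

text \<open>The vertices are prescribed along with the edges: they cover \<open>n = 0\<close>, and
  in the induction the last one is where the next edge is attached.\<close>

lemma spine_fill:
  assumes "\<And>i. i \<le> n \<Longrightarrow> v i \<in> simplices Y 0" "\<And>i. i < n \<Longrightarrow> e i \<in> simplices Y 1"
    and "\<And>i. i < n \<Longrightarrow> vertex Y 1 0 (e i) = v i" "\<And>i. i < n \<Longrightarrow> vertex Y 1 1 (e i) = v (Suc i)"
  shows "\<exists>y\<in>simplices Y n. (\<forall>i\<le>n. vertex Y n i y = v i) \<and> (\<forall>i<n. edge Y n i (Suc i) y = e i)"
  using assms
proof (induction n)
  case 0
  then show ?case by (intro bexI[of _ "v 0"]) (simp_all add: vertex_self)
next
  case (Suc n)
  have "\<exists>y\<in>simplices Y n. (\<forall>i\<le>n. vertex Y n i y = v i) \<and> (\<forall>i<n. edge Y n i (Suc i) y = e i)"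
    by (rule Suc.IH) (use Suc.prems in simp_all)
  then obtain x where x: "x \<in> simplices Y n" "\<And>i. i \<le> n \<Longrightarrow> vertex Y n i x = v i"
    "\<And>i. i < n \<Longrightarrow> edge Y n i (Suc i) x = e i" by blast
  have "vertex Y n n x = vertex Y 1 0 (e n)" using x(2) Suc.prems(3) by simp
  from pullback_squareE[OF spine[of n] x(1) Suc.prems(2)[OF lessI] this] obtain y where
    y: "y \<in> simplices Y (Suc n)" "pull Y n (Suc n) (\<lambda>t. t) y = x"
    "edge Y (Suc n) n (Suc n) y = e n" .
  have "vertex Y (Suc n) i y = v i" if "i \<le> Suc n" for i
  proof (cases "i = Suc n")
    case True
    then show ?thesis
      using vertex_edge(2)[OF y(1), of n "Suc n"] y(3) Suc.prems(4)[of n] by simp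
  next
    case False
    then show ?thesis using that x(2)[of i] vertex_pull[OF y(1), of n "\<lambda>t. t" i] y(2)
      by (simp add: smap_id)
  qed
  moreover have "edge Y (Suc n) i (Suc i) y = e i" if "i < Suc n" for i
  proof (cases "i = n")
    case True
    then show ?thesis using y(3) by simp
  next
    case False
    then show ?thesis using that x(3)[of i] edge_pull[OF y(1), of n "\<lambda>t. t" i "Suc i"] y(2)
      by (simp add: smap_id)
  qed
  ultimately show ?case using y(1) by blast
qed

lemma fill_2:
  assumes "f \<in> simplices Y 1" "g \<in> simplices Y 1" "vertex Y 1 0 g = vertex Y 1 1 f"
  obtains y where "y \<in> simplices Y 2" "edge Y 2 0 1 y = f" "edge Y 2 1 2 y = g"
proof -
  let ?v = "(!) [vertex Y 1 0 f, vertex Y 1 1 f, vertex Y 1 1 g]"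
  have "\<exists>y\<in>simplices Y 2. (\<forall>i\<le>2. vertex Y 2 i y = ?v i) \<and> (\<forall>i<2. edge Y 2 i (Suc i) y = [f, g] ! i)"
    by (rule spine_fill) (use assms in \<open>auto simp: le_Suc_eq less_Suc_eq numeral_2_eq_2\<close>)
  then show ?thesis using that by (auto simp: numeral_2_eq_2)
qed

lemma fill_3:
  assumes "f \<in> simplices Y 1" "g \<in> simplices Y 1" "h \<in> simplices Y 1"
    and "vertex Y 1 0 g = vertex Y 1 1 f" "vertex Y 1 0 h = vertex Y 1 1 g"
  obtains y where "y \<in> simplices Y 3" "edge Y 3 0 1 y = f" "edge Y 3 1 2 y = g" "edge Y 3 2 3 y = h"
proof -
  let ?v = "(!) [vertex Y 1 0 f, vertex Y 1 1 f, vertex Y 1 1 g, vertex Y 1 1 h]"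
  have "\<exists>y\<in>simplices Y 3. (\<forall>i\<le>3. vertex Y 3 i y = ?v i) \<and> (\<forall>i<3. edge Y 3 i (Suc i) y = [f, g, h] ! i)"
    by (rule spine_fill) (use assms in \<open>auto simp: le_Suc_eq less_Suc_eq numeral_3_eq_3\<close>)
  then show ?thesis using that by (auto simp: numeral_3_eq_3 numeral_2_eq_2)
qed

text \<open>For a composable pair the triangle exists by \<open>fill_2\<close> and is unique by
  \<open>spine_eqI\<close>; on other pairs the value is not controlled.\<close>

definition comp :: "'a \<Rightarrow> 'a \<Rightarrow> 'a" where
  "comp g f = edge Y 2 0 2 (THE y. y \<in> simplices Y 2 \<and> edge Y 2 0 1 y = f \<and> edge Y 2 1 2 y = g)"

text \<open>The face of \<open>y\<close> on \<open>i, j, k\<close> is the triangle chosen by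
  \<open>comp\<close>. Hence composites can be read off any simplex that contains the
  arrows.\<close>

lemma comp_edges:
  assumes y: "y \<in> simplices Y n" and le: "i \<le> j" "j \<le> k" "k \<le> n"
  shows "comp (edge Y n j k y) (edge Y n i j y) = edge Y n i k y"
proof -
  let ?t = "pull Y 2 n ((!) [i, j, k]) y"
  have t: "?t \<in> simplices Y 2" "edge Y 2 0 1 ?t = edge Y n i j y" "edge Y 2 1 2 ?t = edge Y n j k y"
    "edge Y 2 0 2 ?t = edge Y n i k y"
    using y le by (simp_all add: pull_closed edge_pull)
  have "(THE w. w \<in> simplices Y 2 \<and> edge Y 2 0 1 w = edge Y n i j y \<and> edge Y 2 1 2 w = edge Y n j k y) = ?t"
  proof (rule the_equality)
    fix w assume w: "w \<in> simplices Y 2 \<and> edge Y 2 0 1 w = edge Y n i j y \<and> edge Y 2 1 2 w = edge Y n j k y"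
    show "w = ?t"
    proof (rule spine_eqI[of _ 2])
      have "vertex Y 2 0 w = vertex Y 1 0 (edge Y 2 0 1 w)"
        "vertex Y 2 0 ?t = vertex Y 1 0 (edge Y 2 0 1 ?t)"
        using w t(1) by (intro vertex_edge(1)[symmetric]; simp)+
      then show "vertex Y 2 0 w = vertex Y 2 0 ?t" using w t(2) by simp
      show "edge Y 2 i (Suc i) w = edge Y 2 i (Suc i) ?t" if "i < 2" for i
        using that w t(2,3) by (cases i) (auto simp: numeral_2_eq_2)
    qed (use w t(1) in simp_all)
  qed (use t in simp)
  then show ?thesis unfolding comp_def using t(4) by simp
qed

definition seg_cat :: "('a, 'a) cat" where
  "seg_cat = \<lparr>Obj = simplices Y 0, Arr = simplices Y 1, Dom = vertex Y 1 0, Cod = vertex Y 1 1,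
     Id = edge Y 0 0 0, Comp = comp\<rparr>"

lemma seg_cat_simps [simp]:
  "Obj seg_cat = simplices Y 0" "Arr seg_cat = simplices Y 1"
  "Dom seg_cat = vertex Y 1 0" "Cod seg_cat = vertex Y 1 1"
  "Id seg_cat = edge Y 0 0 0" "Comp seg_cat = comp"
  by (simp_all add: seg_cat_def)

text \<open>Units come from the degenerate triangles \<open>0 0 1\<close> and \<open>0 1 1\<close>
  on \<open>f\<close>. For associativity, both bracketings are the edge from 0 to 3 of the 3-simplex
  with spine \<open>f, g, h\<close>.\<close>

lemma category_seg_cat: "category seg_cat"
  unfolding category_def seg_cat_simps
proof (intro conjI ballI impI)
  fix f assume f: "f \<in> simplices Y 1"
  show "comp f (edge Y 0 0 0 (vertex Y 1 0 f)) = f"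
    using comp_edges[OF f, of 0 0 1] f by (simp add: edge_vertex edge_self del: One_nat_def)
  show "comp (edge Y 0 0 0 (vertex Y 1 1 f)) f = f"
    using comp_edges[OF f, of 0 1 1] f by (simp add: edge_vertex edge_self del: One_nat_def)
next
  fix f g assume fg: "f \<in> simplices Y 1" "g \<in> simplices Y 1" "vertex Y 1 0 g = vertex Y 1 1 f"
  then obtain y where y: "y \<in> simplices Y 2" "edge Y 2 0 1 y = f" "edge Y 2 1 2 y = g"
    by (rule fill_2)
  have c: "comp g f = edge Y 2 0 2 y" using comp_edges[OF y(1), of 0 1 2] y by simp
  show "comp g f \<in> simplices Y 1" "vertex Y 1 0 (comp g f) = vertex Y 1 0 f"
    "vertex Y 1 1 (comp g f) = vertex Y 1 1 g"
    unfolding c y(2,3)[symmetric] using y(1) by (simp_all add: comp_edges vertex_edge del: One_nat_def)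
next
  fix f g h assume "f \<in> simplices Y 1" "g \<in> simplices Y 1" "h \<in> simplices Y 1"
    "vertex Y 1 0 g = vertex Y 1 1 f" "vertex Y 1 0 h = vertex Y 1 1 g"
  then obtain y where y: "y \<in> simplices Y 3" "edge Y 3 0 1 y = f" "edge Y 3 1 2 y = g" "edge Y 3 2 3 y = h"
    by (rule fill_3)
  show "comp h (comp g f) = comp (comp h g) f"
    unfolding y(2-4)[symmetric] using y(1) by (simp add: comp_edges del: One_nat_def)
qed (auto simp: vertex_edge vertex_self simp del: One_nat_def)

section \<open>Comparison of simplices with functors from \<open>[n]\<close>\<close>

definition to_nerve :: "nat \<Rightarrow> 'a \<Rightarrow> (nat \<Rightarrow> 'a) \<times> (nat \<times> nat \<Rightarrow> 'a)" where
  "to_nerve n y = (restrict (\<lambda>i. vertex Y n i y) {..n},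
     restrict (\<lambda>(i, j). edge Y n i j y) {(i, j). i \<le> j \<and> j \<le> n})"

lemma to_nerve_mem:
  assumes "y \<in> simplices Y n" "\<And>i j. i \<le> j \<Longrightarrow> j \<le> n \<Longrightarrow> edge Y n i j y \<in> L"
  shows "to_nerve n y \<in> simplex_functors n (subcat seg_cat L)"
  using assms unfolding to_nerve_def simplex_functors_def subcat_def
  by (auto simp: vertex_edge edge_vertex comp_edges simp del: One_nat_def)

text \<open>The operators of a nerve only reindex, so the category \<open>D\<close> is
  arbitrary.\<close>

lemma to_nerve_act:
  assumes "f \<in> Delta m n" "y \<in> simplices Y n"
  shows "to_nerve m (act Y m n f y) = act (nerve D) m n f (to_nerve n y)"
  using assms Delta_smap[OF assms(1)] unfolding to_nerve_def act_eq_pull[OF assms(1), of Y] nerve_def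
  by (auto simp: fun_eq_iff restrict_def vertex_pull edge_pull smap_def)

text \<open>A functor on \<open>[n]\<close> is determined by its consecutive arrows: induction on
  \<open>j\<close> builds the arrow \<open>(i, j)\<close> from an identity by composing with one of
  them at a time.\<close>

lemma nerve_eq_to_nerve:
  assumes F: "(F\<^sub>0, F\<^sub>1) \<in> simplex_functors n (subcat seg_cat L)" and y: "y \<in> simplices Y n"
    and v: "\<And>i. i \<le> n \<Longrightarrow> F\<^sub>0 i = vertex Y n i y"
    and e: "\<And>i. i < n \<Longrightarrow> F\<^sub>1 (i, Suc i) = edge Y n i (Suc i) y"
  shows "(F\<^sub>0, F\<^sub>1) = to_nerve n y"
proof -
  have id: "F\<^sub>1 (i, i) = edge Y 0 0 0 (F\<^sub>0 i)" if "i \<le> n" for i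
    using F that by (simp add: simplex_functors_def subcat_def)
  have cmp: "F\<^sub>1 (i, k) = comp (F\<^sub>1 (j, k)) (F\<^sub>1 (i, j))" if "i \<le> j" "j \<le> k" "k \<le> n" for i j k
    using F that by (auto simp: simplex_functors_def subcat_def)
  have "F\<^sub>1 (i, j) = edge Y n i j y" if "i \<le> j" "j \<le> n" for i j
    using that
  proof (induction j rule: dec_induct)
    case base
    then show ?case using id v y by (simp add: edge_vertex)
  next
    case (step j)
    then show ?case using cmp[of i j "Suc j"] e y by (simp add: comp_edges)
  qed
  moreover have "F\<^sub>0 \<in> extensional {..n}" "F\<^sub>1 \<in> extensional {(i, j). i \<le> j \<and> j \<le> n}"
    using F by (auto simp: simplex_functors_def PiE_def)
  ultimately show ?thesis
    unfolding to_nerve_def using v by (auto simp: fun_eq_iff restrict_def extensional_def)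
qed

end

text \<open>The comparison map is built from the simplicial set to the nerve, whereas the
  isomorphisms are stated in the other direction.\<close>

lemma sset_iso_sym:
  assumes "X \<cong>\<^sub>s Y" "simplicial_set X"
  shows "Y \<cong>\<^sub>s X"
proof -
  obtain \<phi> where bij: "\<And>n. bij_betw (\<phi> n) (simplices X n) (simplices Y n)"
    and nat: "\<And>m n f x. f \<in> Delta m n \<Longrightarrow> x \<in> simplices X n \<Longrightarrow>
      \<phi> m (act X m n f x) = act Y m n f (\<phi> n x)"
    using assms(1) unfolding sset_iso_def by blast
  let ?\<psi> = "\<lambda>n. inv_into (simplices X n) (\<phi> n)"
  have "?\<psi> m (act Y m n f y) = act X m n f (?\<psi> n y)"
    if f: "f \<in> Delta m n" and y: "y \<in> simplices Y n" for m n f y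
  proof -
    have x: "?\<psi> n y \<in> simplices X n" "\<phi> n (?\<psi> n y) = y"
      using bij[of n] y by (auto simp: bij_betw_def inv_into_into f_inv_into_f)
    have "act X m n f (?\<psi> n y) \<in> simplices X m"
      using assms(2) f x(1) unfolding simplicial_set_def by blast
    then show ?thesis
      using nat[OF f x(1)] x(2) bij[of m] by (metis bij_betw_inv_into_left)
  qed
  then show ?thesis
    unfolding sset_iso_def using bij bij_betw_inv_into by (intro exI[of _ ?\<psi>]) blast
qed

text \<open>Simplicial form of a wide subcategory: injectivity on edges makes the inclusion
  faithful, and bijectivity on vertices means that no object is lost or identified.\<close>

locale segal_inclusion = Y: segal_set Y + Z: segal_set Z for Y Z :: "'a sset" +
  fixes \<iota> :: "nat \<Rightarrow> 'a \<Rightarrow> 'a"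
  assumes incl_closed [simp]: "z \<in> simplices Z n \<Longrightarrow> \<iota> n z \<in> simplices Y n"
    and incl_pull: "smap m n f \<Longrightarrow> z \<in> simplices Z n \<Longrightarrow> \<iota> m (pull Z m n f z) = pull Y m n f (\<iota> n z)"
    and incl_inj: "inj_on (\<iota> n) (simplices Z n)"
    and incl_vertices: "simplices Y 0 \<subseteq> \<iota> 0 ` simplices Z 0"
begin

abbreviation arrows :: "'a set" where
  "arrows \<equiv> \<iota> 1 ` simplices Z 1"

lemma incl_vertex: "z \<in> simplices Z n \<Longrightarrow> i \<le> n \<Longrightarrow> vertex Y n i (\<iota> n z) = \<iota> 0 (vertex Z n i z)"
  unfolding vertex_def by (simp add: incl_pull)

lemma incl_edge:
  "z \<in> simplices Z n \<Longrightarrow> i \<le> j \<Longrightarrow> j \<le> n \<Longrightarrow> edge Y n i j (\<iota> n z) = \<iota> 1 (edge Z n i j z)"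
  unfolding edge_def by (simp add: incl_pull)

text \<open>Injectivity on vertices makes arrows of \<open>Z\<close> composable as soon as their
  images are. The inclusion then carries the triangle filling them in \<open>Z\<close> to one in
  \<open>Y\<close>, so the composite is again an image.\<close>

lemma wide_subcategory_arrows: "wide_subcategory Y.seg_cat arrows"
  unfolding wide_subcategory_def Y.seg_cat_simps
proof (intro conjI ballI impI)
  show "arrows \<subseteq> simplices Y 1" by auto
next
  fix x assume "x \<in> simplices Y 0"
  then obtain z where "z \<in> simplices Z 0" "x = \<iota> 0 z" using incl_vertices by blast
  then show "edge Y 0 0 0 x \<in> arrows" by (simp add: incl_edge del: One_nat_def)
next
  fix f g assume "f \<in> arrows" "g \<in> arrows" and eq: "vertex Y 1 0 g = vertex Y 1 1 f"
  then obtain a b where ab: "a \<in> simplices Z 1" "b \<in> simplices Z 1" "f = \<iota> 1 a" "g = \<iota> 1 b"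
    by blast
  have "vertex Z 1 0 b = vertex Z 1 1 a"
    by (rule inj_onD[OF incl_inj[of 0]]) (use eq ab in \<open>simp_all add: incl_vertex del: One_nat_def\<close>)
  from Z.fill_2[OF ab(1,2) this] obtain w where
    w: "w \<in> simplices Z 2" "edge Z 2 0 1 w = a" "edge Z 2 1 2 w = b" .
  have "Y.comp (edge Y 2 1 2 (\<iota> 2 w)) (edge Y 2 0 1 (\<iota> 2 w)) = edge Y 2 0 2 (\<iota> 2 w)"
    by (rule Y.comp_edges) (simp_all add: w)
  then have "Y.comp g f = \<iota> 1 (edge Z 2 0 2 w)"
    using w ab by (simp add: incl_edge del: One_nat_def)
  then show "Y.comp g f \<in> arrows" using w(1) by (simp del: One_nat_def)
qed

lemma nerve_subcat_arrows: "nerve (subcat Y.seg_cat arrows) \<cong>\<^sub>s Z"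
proof (rule sset_iso_sym)
  let ?N = "nerve (subcat Y.seg_cat arrows)"
  let ?\<phi> = "\<lambda>n z. Y.to_nerve n (\<iota> n z)"
  have N: "simplices ?N n = simplex_functors n (subcat Y.seg_cat arrows)" for n
    by (simp add: nerve_def)
  have "bij_betw (?\<phi> n) (simplices Z n) (simplices ?N n)" for n
    unfolding bij_betw_def
  proof
    show "inj_on (?\<phi> n) (simplices Z n)"
    proof (rule inj_onI)
      fix x y assume xy: "x \<in> simplices Z n" "y \<in> simplices Z n" "?\<phi> n x = ?\<phi> n y"
      have "vertex Y n i (\<iota> n x) = vertex Y n i (\<iota> n y)" if "i \<le> n" for i
        using fun_cong[OF arg_cong[OF xy(3), of fst], of i] that by (simp add: Y.to_nerve_def)
      moreover have "edge Y n i j (\<iota> n x) = edge Y n i j (\<iota> n y)" if "i \<le> j" "j \<le> n" for i j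
        using fun_cong[OF arg_cong[OF xy(3), of snd], of "(i, j)"] that by (simp add: Y.to_nerve_def)
      ultimately have "\<iota> n x = \<iota> n y"
        using xy by - (rule Y.spine_eqI[of _ n], simp_all)
      then show "x = y" using xy incl_inj by (metis inj_onD)
    qed
    show "?\<phi> n ` simplices Z n = simplices ?N n"
    proof
      show "?\<phi> n ` simplices Z n \<subseteq> simplices ?N n"
        unfolding N by (auto intro!: Y.to_nerve_mem simp: incl_edge simp del: One_nat_def)
      show "simplices ?N n \<subseteq> ?\<phi> n ` simplices Z n"
      proof
        fix F assume "F \<in> simplices ?N n"
        then obtain F\<^sub>0 F\<^sub>1 where FF: "F = (F\<^sub>0, F\<^sub>1)"
          and F: "(F\<^sub>0, F\<^sub>1) \<in> simplex_functors n (subcat Y.seg_cat arrows)"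
          unfolding N by (cases F) auto
        \<comment> \<open>Surjectivity: the spine of the functor is lifted to \<open>Z\<close> and
          filled there. The lifted edges match at their endpoints because \<open>\<iota> 0\<close>
          is injective.\<close>
        define v where "v i = inv_into (simplices Z 0) (\<iota> 0) (F\<^sub>0 i)" for i
        define e where "e i = inv_into (simplices Z 1) (\<iota> 1) (F\<^sub>1 (i, Suc i))" for i
        have F0: "F\<^sub>0 i \<in> \<iota> 0 ` simplices Z 0" if "i \<le> n" for i
          using F that incl_vertices by (auto simp: simplex_functors_def subcat_def PiE_iff)
        have F1: "F\<^sub>1 (i, Suc i) \<in> arrows" "vertex Y 1 0 (F\<^sub>1 (i, Suc i)) = F\<^sub>0 i"
          "vertex Y 1 1 (F\<^sub>1 (i, Suc i)) = F\<^sub>0 (Suc i)" if "i < n" for i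
          using F that by (auto simp: simplex_functors_def subcat_def PiE_iff)
        have v: "v i \<in> simplices Z 0" "\<iota> 0 (v i) = F\<^sub>0 i" if "i \<le> n" for i
          unfolding v_def using F0[OF that] by (simp_all add: inv_into_into f_inv_into_f)
        have e: "e i \<in> simplices Z 1" "\<iota> 1 (e i) = F\<^sub>1 (i, Suc i)" if "i < n" for i
          unfolding e_def using F1(1)[OF that] by (rule inv_into_into, rule f_inv_into_f)
        have src: "vertex Z 1 0 (e i) = v i" if "i < n" for i
          by (rule inj_onD[OF incl_inj[of 0]])
            (use F1(2) e v that in \<open>simp_all add: incl_vertex[symmetric] del: One_nat_def\<close>)
        have tgt: "vertex Z 1 1 (e i) = v (Suc i)" if "i < n" for i
          by (rule inj_onD[OF incl_inj[of 0]])
            (use F1(3) e v that in \<open>simp_all add: incl_vertex[symmetric] del: One_nat_def\<close>)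
        have "\<exists>z\<in>simplices Z n. (\<forall>i\<le>n. vertex Z n i z = v i) \<and> (\<forall>i<n. edge Z n i (Suc i) z = e i)"
          by (rule Z.spine_fill) (use v e src tgt in auto)
        then obtain z where z: "z \<in> simplices Z n" "\<And>i. i \<le> n \<Longrightarrow> vertex Z n i z = v i"
          "\<And>i. i < n \<Longrightarrow> edge Z n i (Suc i) z = e i" by blast
        have "(F\<^sub>0, F\<^sub>1) = ?\<phi> n z"
          by (rule Y.nerve_eq_to_nerve[OF F])
            (use z v(2) e(2) in \<open>simp_all add: incl_vertex incl_edge del: One_nat_def\<close>)
        with FF z(1) show "F \<in> ?\<phi> n ` simplices Z n" by blast
      qed
    qed
  qed
  moreover have "?\<phi> m (act Z m n f z) = act ?N m n f (?\<phi> n z)"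
    if "f \<in> Delta m n" "z \<in> simplices Z n" for m n f z
    using that Y.to_nerve_act[OF that(1), of "\<iota> n z"]
    by (simp add: act_eq_pull incl_pull Delta_smap)
  ultimately show "Z \<cong>\<^sub>s ?N"
    unfolding sset_iso_def by (intro exI[of _ ?\<phi>]) blast
qed simp

end

section \<open>The subdivision and the decalages of a 2-Segal set\<close>

lemma pull_sd:
  "pull (sd X) m n f =
    pull X (2 * m + 1) (2 * n + 1) (\<lambda>t. if t \<le> m then n - f (m - t) else n + 1 + f (t - m - 1))"
  unfolding pull_def sd_def sset.simps Q_map_def
  by (rule arg_cong[of _ _ "\<lambda>h. act X (2 * m + 1) (2 * n + 1) h"]) (auto simp: restrict_def fun_eq_iff)

lemma pull_op_dec_top:
  "pull (op_sset (dec_top X)) m n f =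
    pull X (Suc m) (Suc n) (\<lambda>t. if t \<le> m then n - f (m - t) else Suc n)"
  unfolding pull_def op_sset_def dec_top_def sset.simps top_map_def op_map_def
  by (rule arg_cong[of _ _ "\<lambda>h. act X (Suc m) (Suc n) h"]) (auto simp: restrict_def fun_eq_iff)

lemma pull_dec_bot:
  "pull (dec_bot X) m n f = pull X (Suc m) (Suc n) (\<lambda>t. if t = 0 then 0 else Suc (f (t - 1)))"
  unfolding pull_def dec_bot_def sset.simps bot_map_def
  by (rule arg_cong[of _ _ "\<lambda>h. act X (Suc m) (Suc n) h"]) (auto simp: restrict_def fun_eq_iff)

lemma smap_sd:
  "smap m n f \<Longrightarrow>
    smap (2 * m + 1) (2 * n + 1) (\<lambda>t. if t \<le> m then n - f (m - t) else n + 1 + f (t - m - 1))"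
  unfolding smap_def by (auto simp: diff_le_mono2)

lemma smap_op_dec_top:
  "smap m n f \<Longrightarrow> smap (Suc m) (Suc n) (\<lambda>t. if t \<le> m then n - f (m - t) else Suc n)"
  unfolding smap_def by (auto simp: diff_le_mono2)

lemma smap_dec_bot:
  "smap m n f \<Longrightarrow> smap (Suc m) (Suc n) (\<lambda>t. if t = 0 then 0 else Suc (f (t - 1)))"
  unfolding smap_def by auto

lemma simplices_shifts [simp]:
  "simplices (sd X) n = simplices X (2 * n + 1)"
  "simplices (op_sset (dec_top X)) n = simplices X (Suc n)"
  "simplices (dec_bot X) n = simplices X (Suc n)"
  by (simp_all add: sd_def op_sset_def dec_top_def dec_bot_def)

section \<open>Segal conditions for the subdivision and the decalages\<close>

lemma segal_sd:
  assumes X: "two_segal X"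
  shows "segal_set (sd X)"
proof
  show "simplicial_set (sd X)"
    using X by (simp add: simplicial_set_sd two_segal_def upper_two_segal_def)
  fix n
  \<comment> \<open>The last vertex of \<open>[n + 1]\<close> corresponds to the outermost pair
    \<open>0, 2 * n + 3\<close> of \<open>X\<close>, and the last spine edge to the quadrilateral on
    the two outermost pairs; hence \<open>m = 2 * n\<close>.\<close>
  have sq: "pullback_square (simplices (sd X) (Suc n)) (simplices (sd X) n) (simplices (sd X) 1)
    (pull X (Suc (2 * n)) (Suc (Suc (Suc (2 * n)))) Suc)
    (pull X 3 (Suc (Suc (Suc (2 * n)))) ((!) [0, 1, Suc (Suc (2 * n)), Suc (Suc (Suc (2 * n)))]))
    (pull X 1 (Suc (2 * n)) ((!) [0, Suc (2 * n)])) (pull X 1 3 ((!) [1, 2]))"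
    using two_segal_quadrilateral[OF X, of "2 * n"] by (simp add: numeral_3_eq_3 del: One_nat_def) simp
  show "pullback_square (simplices (sd X) (Suc n)) (simplices (sd X) n) (simplices (sd X) 1)
      (pull (sd X) n (Suc n) (\<lambda>t. t)) (edge (sd X) (Suc n) n (Suc n)) (vertex (sd X) n n) (vertex (sd X) 1 0)"
    unfolding vertex_def edge_def pull_sd
    by (rule pullback_square_cong[OF sq])
      (simp_all add: numeral_3_eq_3, (rule fun_cong[OF pull_cong], auto simp: all_le_small)+)
qed

text \<open>Passing to the opposite makes the last vertex correspond to vertex 0 of
  \<open>X\<close>, so dropping it is the bottom face, while the top vertex \<open>n + 2\<close>
  stays as the apex of the fan.\<close>

lemma segal_op_dec_top:
  assumes X: "upper_two_segal X"
  shows "segal_set (op_sset (dec_top X))"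
proof
  show "simplicial_set (op_sset (dec_top X))"
    using X by (simp add: simplicial_set_op simplicial_set_dec_top upper_two_segal_def)
  fix n
  have sq: "pullback_square (simplices (op_sset (dec_top X)) (Suc n)) (simplices (op_sset (dec_top X)) n)
    (simplices (op_sset (dec_top X)) 1)
    (pull X (Suc n) (Suc (Suc n)) Suc) (pull X 2 (Suc (Suc n)) ((!) [0, 1, Suc (Suc n)]))
    (pull X 1 (Suc n) ((!) [0, Suc n])) (pull X 1 2 ((!) [1, 2]))"
    using upper_two_segal_ear[OF X, of n] by (simp flip: numeral_2_eq_2)
  show "pullback_square (simplices (op_sset (dec_top X)) (Suc n)) (simplices (op_sset (dec_top X)) n)
      (simplices (op_sset (dec_top X)) 1)
      (pull (op_sset (dec_top X)) n (Suc n) (\<lambda>t. t)) (edge (op_sset (dec_top X)) (Suc n) n (Suc n))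
      (vertex (op_sset (dec_top X)) n n) (vertex (op_sset (dec_top X)) 1 0)"
    unfolding vertex_def edge_def pull_op_dec_top
    by (rule pullback_square_cong[OF sq])
      (simp_all add: numeral_2_eq_2, (rule fun_cong[OF pull_cong], auto simp: all_le_small)+)
qed

lemma segal_dec_bot:
  assumes X: "lower_two_segal X"
  shows "segal_set (dec_bot X)"
proof
  show "simplicial_set (dec_bot X)"
    using X by (simp add: simplicial_set_dec_bot lower_two_segal_def)
  fix n
  have sq: "pullback_square (simplices (dec_bot X) (Suc n)) (simplices (dec_bot X) n) (simplices (dec_bot X) 1)
    (pull X (Suc n) (Suc (Suc n)) (\<lambda>t. t)) (pull X 2 (Suc (Suc n)) ((!) [0, Suc n, Suc (Suc n)]))
    (pull X 1 (Suc n) ((!) [0, Suc n])) (pull X 1 2 ((!) [0, 1]))"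
    using lower_two_segal_ear[OF X, of n] by (simp flip: numeral_2_eq_2)
  show "pullback_square (simplices (dec_bot X) (Suc n)) (simplices (dec_bot X) n) (simplices (dec_bot X) 1)
      (pull (dec_bot X) n (Suc n) (\<lambda>t. t)) (edge (dec_bot X) (Suc n) n (Suc n))
      (vertex (dec_bot X) n n) (vertex (dec_bot X) 1 0)"
    unfolding vertex_def edge_def pull_dec_bot
    by (rule pullback_square_cong[OF sq])
      (simp_all add: numeral_2_eq_2, (rule fun_cong[OF pull_cong], auto simp: all_le_small)+)
qed

text \<open>Restriction along \<open>[n]\<^sup>o\<^sup>p \<star> [n] \<rightarrow> [n]\<^sup>o\<^sup>p \<star> [0]\<close> and \<open>[n]\<^sup>o\<^sup>p \<star> [n] \<rightarrow> [0] \<star> [n]\<close>.\<close>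

definition left_incl :: "'a sset \<Rightarrow> nat \<Rightarrow> 'a \<Rightarrow> 'a" where
  "left_incl X n = pull X (2 * n + 1) (Suc n) (\<lambda>t. min t (Suc n))"

definition right_incl :: "'a sset \<Rightarrow> nat \<Rightarrow> 'a \<Rightarrow> 'a" where
  "right_incl X n = pull X (2 * n + 1) (Suc n) (\<lambda>t. t - n)"

lemma smap_incl:
  "smap (2 * n + 1) (Suc n) (\<lambda>t. min t (Suc n))" "smap (2 * n + 1) (Suc n) (\<lambda>t. t - n)"
  by (auto simp: smap_def)

text \<open>Restriction to the first \<open>n + 2\<close> vertices undoes \<open>left_incl\<close>,
  which gives injectivity. Compatibility with operators holds since \<open>min\<close> collapses the
  whole unprimed half to the apex \<open>n + 1\<close>.\<close>

lemma segal_inclusion_left: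
  assumes X: "two_segal X"
  shows "segal_inclusion (sd X) (op_sset (dec_top X)) (left_incl X)"
proof -
  have sX [simp]: "simplicial_set X" using X by (simp add: two_segal_def upper_two_segal_def)
  interpret Y: segal_set "sd X" by (rule segal_sd[OF X])
  interpret Z: segal_set "op_sset (dec_top X)"
    using X by (intro segal_op_dec_top) (simp add: two_segal_def)
  have retract: "pull X (Suc n) (2 * n + 1) (\<lambda>t. t) (left_incl X n z) = z" if "z \<in> simplices X (Suc n)" for n z
  proof -
    have "pull X (Suc n) (2 * n + 1) (\<lambda>t. t) (left_incl X n z) = pull X (Suc n) (Suc n) (\<lambda>t. t) z"
      unfolding left_incl_def by (rule pull_pull_eq) (use that smap_incl in \<open>auto simp: smap_id\<close>)
    then show ?thesis using that by (simp add: pull_id)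
  qed
  show ?thesis
  proof
    show "left_incl X n z \<in> simplices (sd X) n" if "z \<in> simplices (op_sset (dec_top X)) n" for n z
      using that smap_incl(1)[of n] by (simp add: left_incl_def pull_closed)
    show "left_incl X m (pull (op_sset (dec_top X)) m n f z) = pull (sd X) m n f (left_incl X n z)"
      if f: "smap m n f" and z: "z \<in> simplices (op_sset (dec_top X)) n" for m n f z
    proof -
      have "f (t - Suc m) \<le> n" if "t \<le> 2 * m + 1" for t using f that by (simp add: smap_def)
      then show ?thesis
        unfolding left_incl_def pull_op_dec_top pull_sd
        using z smap_sd[OF f] smap_op_dec_top[OF f] smap_incl(1)[of m] smap_incl(1)[of n]
        by (simp add: pull_pull) (rule fun_cong[OF pull_cong], auto)
    qed
    show "inj_on (left_incl X n) (simplices (op_sset (dec_top X)) n)" for n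
      by (rule inj_on_inverseI[of _ "pull X (Suc n) (2 * n + 1) (\<lambda>t. t)"]) (simp add: retract del: One_nat_def)
    show "simplices (sd X) 0 \<subseteq> left_incl X 0 ` simplices (op_sset (dec_top X)) 0"
    proof
      fix x assume x: "x \<in> simplices (sd X) 0"
      \<comment> \<open>In degree 0 both sides are the edges of \<open>X\<close>, and
        \<open>min t 1\<close> is the identity on \<open>{0, 1}\<close>.\<close>
      then have "left_incl X 0 x = x" by (auto simp: left_incl_def intro: pull_id)
      then show "x \<in> left_incl X 0 ` simplices (op_sset (dec_top X)) 0" using x by force
    qed
  qed
qed

text \<open>Here the last \<open>n + 2\<close> vertices recover the simplex, via the section
  \<open>t + n\<close> of the truncated subtraction \<open>t - n\<close>, which sends the primed
  half to the apex 0.\<close>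

lemma segal_inclusion_right:
  assumes X: "two_segal X"
  shows "segal_inclusion (sd X) (dec_bot X) (right_incl X)"
proof -
  have sX [simp]: "simplicial_set X" using X by (simp add: two_segal_def upper_two_segal_def)
  interpret Y: segal_set "sd X" by (rule segal_sd[OF X])
  interpret Z: segal_set "dec_bot X"
    using X by (intro segal_dec_bot) (simp add: two_segal_def)
  have s: "smap (Suc n) (2 * n + 1) (\<lambda>t. t + n)" for n by (simp add: smap_def)
  have retract: "pull X (Suc n) (2 * n + 1) (\<lambda>t. t + n) (right_incl X n z) = z" if "z \<in> simplices X (Suc n)" for n z
  proof -
    have "pull X (Suc n) (2 * n + 1) (\<lambda>t. t + n) (right_incl X n z) = pull X (Suc n) (Suc n) (\<lambda>t. t) z"
      unfolding right_incl_def by (rule pull_pull_eq) (use that s smap_incl in auto)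
    then show ?thesis using that by (simp add: pull_id)
  qed
  show ?thesis
  proof
    show "right_incl X n z \<in> simplices (sd X) n" if "z \<in> simplices (dec_bot X) n" for n z
      using that smap_incl(2)[of n] by (simp add: right_incl_def pull_closed)
    show "right_incl X m (pull (dec_bot X) m n f z) = pull (sd X) m n f (right_incl X n z)"
      if f: "smap m n f" and z: "z \<in> simplices (dec_bot X) n" for m n f z
      unfolding right_incl_def pull_dec_bot pull_sd
      using z smap_sd[OF f] smap_dec_bot[OF f] smap_incl(2)[of m] smap_incl(2)[of n]
      by (simp add: pull_pull) (rule fun_cong[OF pull_cong], auto)
    show "inj_on (right_incl X n) (simplices (dec_bot X) n)" for n
      by (rule inj_on_inverseI[of _ "pull X (Suc n) (2 * n + 1) (\<lambda>t. t + n)"]) (simp add: retract del: One_nat_def)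
    show "simplices (sd X) 0 \<subseteq> right_incl X 0 ` simplices (dec_bot X) 0"
    proof
      fix x assume x: "x \<in> simplices (sd X) 0"
      then have "right_incl X 0 x = x" by (auto simp: right_incl_def intro: pull_id)
      then show "x \<in> right_incl X 0 ` simplices (dec_bot X) 0" using x by force
    qed
  qed
qed

text \<open>With the full class of arrows, the result on included Segal sets says that
  \<open>Y\<close> is the nerve of its own category.\<close>

lemma (in segal_set) segal_inclusion_id: "segal_inclusion Y Y (\<lambda>_ y. y)"
  by unfold_locales auto

lemma (in segal_set) nerve_seg_cat: "nerve seg_cat \<cong>\<^sub>s Y"
proof -
  have "subcat seg_cat (simplices Y 1) = seg_cat" by (simp add: subcat_def seg_cat_def)
  then show ?thesis
    using segal_inclusion.nerve_subcat_arrows[OF segal_inclusion_id] by simp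
qed

text \<open>
  Writing a 3-simplex as \<open>1' 0' 0 1\<close>, the 5-simplex \<open>1' 1' 0' 0 0 1\<close> exhibits it as the composite
  in \<open>sd X\<close> of \<open>1' 0' 0 0\<close> and \<open>1' 1' 0 1\<close>.
\<close>

lemma comp_sd_factors:
  assumes X: "two_segal X" and x: "x \<in> simplices X 3"
  shows "segal_set.comp (sd X) (right_incl X 1 (pull X 2 3 ((!) [0, 2, 3]) x))
    (left_incl X 1 (pull X 2 3 ((!) [0, 1, 2]) x)) = x"
proof -
  have sX [simp]: "simplicial_set X" using X by (simp add: two_segal_def upper_two_segal_def)
  interpret Y: segal_set "sd X" by (rule segal_sd[OF X])
  let ?w = "pull X 5 3 ((!) [0, 0, 1, 2, 2, 3]) x"
  have w: "?w \<in> simplices (sd X) 2" using x by (simp add: pull_closed)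
  \<comment> \<open>Vertex \<open>i\<close> of a 2-simplex of \<open>sd X\<close> is the pair
    \<open>2 - i, 3 + i\<close> of vertices of \<open>X\<close>, so the inner list holds the four
    corners of the edge from \<open>i\<close> to \<open>j\<close>.\<close>
  have e: "edge (sd X) 2 i j ?w = pull X 3 3 (\<lambda>t. [0, 0, 1, 2, 2, 3] ! ([2 - j, 2 - i, 3 + i, 3 + j] ! t)) x"
    if "i \<le> j" "j \<le> 2" for i j
  proof -
    have "edge (sd X) 2 i j = pull X 3 5 ((!) [2 - j, 2 - i, 3 + i, 3 + j])"
      unfolding edge_def pull_sd by (simp, rule pull_cong) (simp add: all_le_small)
    moreover have "smap 3 5 ((!) [2 - j, 2 - i, 3 + i, 3 + j])" using that by simp linarith
    ultimately show ?thesis using x by (simp add: pull_pull)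
  qed
  have l: "left_incl X 1 (pull X 2 3 ((!) [0, 1, 2]) x) = edge (sd X) 2 0 1 ?w"
    using x smap_incl(1)[of 1] unfolding e[OF zero_le_one one_le_numeral] left_incl_def
    by (simp add: pull_pull flip: numeral_2_eq_2) (rule fun_cong[OF pull_cong], simp add: all_le_small)
  have r: "right_incl X 1 (pull X 2 3 ((!) [0, 2, 3]) x) = edge (sd X) 2 1 2 ?w"
    using x smap_incl(2)[of 1] unfolding e[OF one_le_numeral order_refl] right_incl_def
    by (simp add: pull_pull flip: numeral_2_eq_2) (rule fun_cong[OF pull_cong], simp add: all_le_small)
  have "edge (sd X) 2 0 2 ?w = x"
    unfolding e[OF zero_le order_refl] using x by (intro pull_id) (simp_all add: all_le_small)
  then show ?thesis
    unfolding l r using Y.comp_edges[OF w, of 0 1 2] by simp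
qed

theorem theorem1p3:
  fixes X :: "'a sset"
  assumes "two_segal X"
  shows "\<exists>(C :: ('a, 'a) cat) L R.
    category C \<and> nerve C \<cong>\<^sub>s sd X \<and>
    strict_factorization_system C L R \<and>
    nerve (subcat C L) \<cong>\<^sub>s op_sset (dec_top X) \<and>
    nerve (subcat C R) \<cong>\<^sub>s dec_bot X"
proof -
  have low: "lower_two_segal X" and sX [simp]: "simplicial_set X"
    using assms by (simp_all add: two_segal_def lower_two_segal_def)
  interpret Y: segal_set "sd X" by (rule segal_sd[OF assms])
  interpret L: segal_inclusion "sd X" "op_sset (dec_top X)" "left_incl X"
    by (rule segal_inclusion_left[OF assms])
  interpret R: segal_inclusion "sd X" "dec_bot X" "right_incl X"
    by (rule segal_inclusion_right[OF assms])
  have sq: "pullback_square (simplices X 3) (simplices X 2) (simplices X 2)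
    (pull X 2 3 ((!) [0, 1, 2])) (pull X 2 3 ((!) [0, 2, 3])) (pull X 1 2 ((!) [0, 2])) (pull X 1 2 ((!) [0, 1]))"
    by (rule pullback_square_cong[OF lower_two_segal_square[OF low]])
      (simp_all, rule fun_cong[OF pull_cong], simp add: all_le_small)
  \<comment> \<open>These are the outer and inner edges. After the collapses, the composability
    condition for a left and a right arrow becomes agreement of the two triangles on the
    diagonal.\<close>
  have "vertex (sd X) 1 1 = pull X 1 3 ((!) [0, 3])" "vertex (sd X) 1 0 = pull X 1 3 ((!) [1, 2])"
    unfolding vertex_def pull_sd by (simp, rule pull_cong, simp add: all_le_small)+
  then have cod: "vertex (sd X) 1 1 (left_incl X 1 a) = pull X 1 2 ((!) [0, 2]) a"
    and dom: "vertex (sd X) 1 0 (right_incl X 1 a) = pull X 1 2 ((!) [0, 1]) a"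
    if "a \<in> simplices X 2" for a
    using that smap_incl[of 1] unfolding left_incl_def right_incl_def
    by (simp_all add: pull_pull flip: numeral_2_eq_2)
      (rule fun_cong[OF pull_cong], simp add: all_le_small)+
  have factorization: "\<exists>!(l, r). l \<in> L.arrows \<and> r \<in> R.arrows \<and> vertex (sd X) 1 0 r = vertex (sd X) 1 1 l \<and> x = Y.comp r l"
    (is "\<exists>!(l, r). ?P l r") if "x \<in> simplices (sd X) 1" for x
  proof -
    have x: "x \<in> simplices X 3" using that by (simp add: numeral_3_eq_3)
    let ?a = "pull X 2 3 ((!) [0, 1, 2]) x" and ?b = "pull X 2 3 ((!) [0, 2, 3]) x"
    have ab: "?a \<in> simplices X 2" "?b \<in> simplices X 2" "pull X 1 2 ((!) [0, 2]) ?a = pull X 1 2 ((!) [0, 1]) ?b"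
      using pullback_square_commutes[OF sq x] by auto
    have uniq: "l = left_incl X 1 ?a \<and> r = right_incl X 1 ?b"
      if lr: "l \<in> L.arrows" "r \<in> R.arrows" "vertex (sd X) 1 0 r = vertex (sd X) 1 1 l" "x = Y.comp r l" for l r
    proof -
      obtain a b where a: "a \<in> simplices X 2" "l = left_incl X 1 a" and b: "b \<in> simplices X 2" "r = right_incl X 1 b"
        using lr(1,2) by (auto simp: numeral_2_eq_2)
      \<comment> \<open>Composability lets the triangles be glued to some \<open>y\<close>. Its two
        factors are \<open>l\<close> and \<open>r\<close>, so \<open>y\<close> is their composite
        \<open>x\<close>, and the triangles are faces of \<open>x\<close>.\<close>
      have "pull X 1 2 ((!) [0, 2]) a = pull X 1 2 ((!) [0, 1]) b"
        using lr(3) cod[OF a(1)] dom[OF b(1)] a(2) b(2) by simp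
      from pullback_squareE[OF sq a(1) b(1) this] obtain y where
        y: "y \<in> simplices X 3" "pull X 2 3 ((!) [0, 1, 2]) y = a" "pull X 2 3 ((!) [0, 2, 3]) y = b" .
      then have "x = y" using comp_sd_factors[OF assms y(1)] lr(4) a(2) b(2) by simp
      then show ?thesis using y a b by simp
    qed
    have "left_incl X 1 ?a \<in> L.arrows" "right_incl X 1 ?b \<in> R.arrows"
      using ab(1,2) by (auto simp: numeral_2_eq_2)
    moreover have "vertex (sd X) 1 0 (right_incl X 1 ?b) = vertex (sd X) 1 1 (left_incl X 1 ?a)"
      by (simp only: cod[OF ab(1)] dom[OF ab(2)] ab(3))
    moreover note comp_sd_factors[OF assms x, symmetric]
    ultimately have ex: "?P (left_incl X 1 ?a) (right_incl X 1 ?b)"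
      by (intro conjI)
    show "\<exists>!(l, r). ?P l r"
    proof (rule ex1I)
      show "case (left_incl X 1 ?a, right_incl X 1 ?b) of (l, r) \<Rightarrow> ?P l r"
        using ex by (simp only: prod.case)
      show "p = (left_incl X 1 ?a, right_incl X 1 ?b)" if "case p of (l, r) \<Rightarrow> ?P l r" for p
        using that uniq[of "fst p" "snd p"] by (simp only: case_prod_beta prod_eq_iff fst_conv snd_conv)
    qed
  qed
  have sfs: "strict_factorization_system Y.seg_cat L.arrows R.arrows"
    unfolding strict_factorization_system_def Y.seg_cat_simps
    by (intro conjI ballI Y.category_seg_cat L.wide_subcategory_arrows R.wide_subcategory_arrows
        factorization)
  show ?thesis
    by (rule exI[of _ Y.seg_cat], rule exI[of _ L.arrows], rule exI[of _ R.arrows])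
      (intro conjI sfs Y.category_seg_cat Y.nerve_seg_cat L.nerve_subcat_arrows
        R.nerve_subcat_arrows)
qed

end
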